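(* There exist universal constants $c,c_1,c_2>0$ such that the following holds. Let $n\in\mathbb{N}$, $\sigma^2>0$, $0<\tau_1\le\dots\le\tau_n$, and $R,L,M,\varepsilon>0$ with $\sqrt L R>c_1\sqrt\varepsilon$ and $M^2R^2>c_2\varepsilon^2$. Let $A=\{A_d\}_{d\in\mathbb{N}}$ be a family of algorithms in $\mathcal{A}^R_{\mathrm{zr}}$ for the time multiple oracles protocol. Then there exist $d$, a function $f\in\mathcal{F}^{\mathrm{conv}}_{R,M,L}$ on $\mathbb{R}^d$, and an admissible choice of oracles and distributions from $\mathcal{O}^{\mathrm{conv},\sigma^2}_{\tau_1,\dots,\tau_n}(f)$ such that $$\mathbb{E}\Big[\inf_{k\in S_t}f(x^k)\Big]-\inf_{x\in B_2(0,R)}f(x)>\varepsilon\ \ \text{for}\ \ t=c\cdot\min_{m\in[n]}\left[\Big(\frac1m\sum_{i=1}^m\frac1{\tau_i}\Big)^{-1}\Big(\min\Big\{\frac{\sqrt LR}{\sqrt\varepsilon},\frac{M^2R^2}{\varepsilon^2}\Big\}+\frac{\sigma^2R^2}{m\varepsilon^2}\Big)\right].$$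
   Context: Notation: $[n]=\{1,\dots,n\}$, $\mathbb{N}_0=\{0,1,2,\dots\}$; $\mathrm{supp}(x)=\{i: x_i\ne0\}$; $B_2(0,R)=\{x\in\mathbb{R}^d:\|x\|\le R\}$. Time multiple oracles protocol. There are $n$ oracles $O_1,\dots,O_n$ with distributions $\mathcal{D}_1,\dots,\mathcal{D}_n$ on a sample space $\mathbb{S}_\xi$. An algorithm is a sequence $A=\{A^k\}_{k\ge0}$ with $A^0\in\mathbb{R}_{\ge0}\times[n]\times\mathbb{R}^d$ and $A^k:(\mathbb{R}^d)^k\to\mathbb{R}_{\ge0}\times[n]\times\mathbb{R}^d$ for $k\ge1$, such that for all $k\ge1$ and all $g^1,\dots,g^k$ the first (time) component of $A^k(g^1,\dots,g^k)$ is at least the first component of $A^{k-1}(g^1,\dots,g^{k-1})$. Each oracle $i$ has a state in $\mathbb{R}_{\ge0}\times\mathbb{R}^d\times\{0,1\}$, initially $s_i^0=(0,0,0)$. Set $t^0=0$. For $k=0,1,2,\dots$: $(t^{k+1},i^{k+1},x^k)=A^k(g^1,\dots,g^k)$ ($=A^0$ for $k=0$); draw $\xi^{k+1}\sim\mathcal{D}_{i^{k+1}}$ independently of everything before; $(s^{k+1}_{i^{k+1}},g^{k+1})=O_{i^{k+1}}(t^{k+1},x^k,s^k_{i^{k+1}},\xi^{k+1})$, and $s^{k+1}_j=s^k_j$ for $j\ne i^{k+1}$. For $t\ge0$, $S_t=\{k\in\mathbb{N}_0: t^k\le t\}$. Delayed oracle. For $\tau>0$ and a mapping $G:\mathbb{R}^d\times\mathbb{S}_\xi\to\mathbb{R}^d$,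 the oracle $O^G_\tau(t,x,(s_t,s_x,s_q),\xi)$ returns $((t,x,1),0)$ if $s_q=0$; $((s_t,s_x,1),0)$ if $s_q=1$ and $t<s_t+\tau$; $((0,0,0),G(s_x;\xi))$ if $s_q=1$ and $t\ge s_t+\tau$. Class $\mathcal{A}^R_{\mathrm{zr}}$: algorithms that are zero-respecting, i.e. $\mathrm{supp}(x^k)\subseteq\bigcup_{j=1}^k\mathrm{supp}(g^j)$ for all $k\in\mathbb{N}_0$ and all realizations, and satisfy $x^k\in B_2(0,R)$ for all $k$. Class $\mathcal{F}^{\mathrm{conv}}_{R,M,L}$: convex differentiable $f:\mathbb{R}^d\to\mathbb{R}$ with $\|\nabla f(x)-\nabla f(y)\|\le L\|x-y\|$ and $|f(x)-f(y)|\le M\|x-y\|$ for all $x,y\in B_2(0,R)$. Oracle class $\mathcal{O}^{\mathrm{conv},\sigma^2}_{\tau_1,\dots,\tau_n}(f)$: an admissible choice is a sample space, distributions $\mathcal{D}_1,\dots,\mathcal{D}_n$ and one mapping $G$ with $\mathbb{E}_{\xi\sim\mathcal{D}_i}[G(x;\xi)]=\nabla f(x)$ and $\mathbb{E}_{\xi\sim\mathcal{D}_i}\|G(x;\xi)-\nabla f(x)\|^2\le\sigma^2$ for all $x\in B_2(0,R)$ and all $i$; the oracles are $O_i=O^G_{\tau_i}$. *)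

theory Defs
  imports "HOL-Probability.Probability"
begin

text \<open>Vectors of R^d are represented as functions nat => real vanishing from index d on
  (coordinates 0..d-1).\<close>
type_synonym vec = "nat \<Rightarrow> real"

definition vecs :: "nat \<Rightarrow> vec set" where
  "vecs d = {x. \<forall>i\<ge>d. x i = 0}"

definition vzero :: vec where "vzero = (\<lambda>_. 0)"

definition vinner :: "nat \<Rightarrow> vec \<Rightarrow> vec \<Rightarrow> real" where
  "vinner d x y = (\<Sum>i<d. x i * y i)"

definition vnorm :: "nat \<Rightarrow> vec \<Rightarrow> real" where
  "vnorm d x = sqrt (vinner d x x)"

definition vball :: "nat \<Rightarrow> real \<Rightarrow> vec set" where
  "vball d R = {x \<in> vecs d. vnorm d x \<le> R}"

definition vsupp :: "vec \<Rightarrow> nat set" where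
  "vsupp x = {i. x i \<noteq> 0}"

definition has_grad :: "nat \<Rightarrow> (vec \<Rightarrow> real) \<Rightarrow> vec \<Rightarrow> vec \<Rightarrow> bool" where
  "has_grad d f g x \<longleftrightarrow> (\<forall>e>0. \<exists>\<delta>>0. \<forall>y\<in>vecs d.
      vnorm d (\<lambda>j. y j - x j) < \<delta> \<longrightarrow>
      \<bar>f y - f x - vinner d g (\<lambda>j. y j - x j)\<bar> \<le> e * vnorm d (\<lambda>j. y j - x j))"

definition differentiable_vec :: "nat \<Rightarrow> (vec \<Rightarrow> real) \<Rightarrow> vec \<Rightarrow> bool" where
  "differentiable_vec d f x \<longleftrightarrow> (\<exists>g\<in>vecs d. has_grad d f g x)"

definition vgrad :: "nat \<Rightarrow> (vec \<Rightarrow> real) \<Rightarrow> vec \<Rightarrow> vec" where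
  "vgrad d f x = (SOME g. g \<in> vecs d \<and> has_grad d f g x)"

definition convex_vec :: "nat \<Rightarrow> (vec \<Rightarrow> real) \<Rightarrow> bool" where
  "convex_vec d f \<longleftrightarrow> (\<forall>x\<in>vecs d. \<forall>y\<in>vecs d. \<forall>u::real. 0 \<le> u \<and> u \<le> 1 \<longrightarrow>
      f (\<lambda>j. u * x j + (1 - u) * y j) \<le> u * f x + (1 - u) * f y)"

definition F_conv :: "nat \<Rightarrow> real \<Rightarrow> real \<Rightarrow> real \<Rightarrow> (vec \<Rightarrow> real) \<Rightarrow> bool" where
  "F_conv d R M L f \<longleftrightarrow> convex_vec d f \<and> (\<forall>x\<in>vecs d. differentiable_vec d f x) \<and>
     (\<forall>x\<in>vball d R. \<forall>y\<in>vball d R.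
        vnorm d (\<lambda>j. vgrad d f x j - vgrad d f y j) \<le> L * vnorm d (\<lambda>j. x j - y j) \<and>
        \<bar>f x - f y\<bar> \<le> M * vnorm d (\<lambda>j. x j - y j))"

definition oracle_ok :: "nat \<Rightarrow> nat \<Rightarrow> real \<Rightarrow> real \<Rightarrow> (vec \<Rightarrow> real)
    \<Rightarrow> (nat \<Rightarrow> real measure) \<Rightarrow> (vec \<Rightarrow> real \<Rightarrow> vec) \<Rightarrow> bool" where
  "oracle_ok d n R \<sigma> f D G \<longleftrightarrow>
     (\<forall>i\<in>{1..n}. prob_space (D i) \<and> sets (D i) = sets borel) \<and>
     (\<forall>x\<in>vecs d. \<forall>\<xi>. G x \<xi> \<in> vecs d) \<and>
     (\<forall>i\<in>{1..n}. \<forall>x\<in>vball d R.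
        (\<forall>j. integrable (D i) (\<lambda>\<xi>. G x \<xi> j) \<and> (\<integral>\<xi>. G x \<xi> j \<partial>D i) = vgrad d f x j) \<and>
        (\<integral>\<^sup>+\<xi>. ennreal ((vnorm d (\<lambda>j. G x \<xi> j - vgrad d f x j))\<^sup>2) \<partial>D i) \<le> ennreal (\<sigma>\<^sup>2))"

text \<open>Algorithms: A gs = A^k(g^1,...,g^k) with k = length gs; values (time, oracle index, point).
  The class A^R_zr (zero-respecting, iterates in the ball), for n oracles in dimension d.\<close>
type_synonym alg = "vec list \<Rightarrow> real \<times> nat \<times> vec"

definition alg_zr :: "nat \<Rightarrow> nat \<Rightarrow> real \<Rightarrow> alg \<Rightarrow> bool" where
  "alg_zr n d R A \<longleftrightarrow> (\<forall>gs. set gs \<subseteq> vecs d \<longrightarrow>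
     (case A gs of (t, i, x) \<Rightarrow> t \<ge> 0 \<and> i \<in> {1..n} \<and> x \<in> vball d R \<and>
         vsupp x \<subseteq> (\<Union>g\<in>set gs. vsupp g)) \<and>
     (\<forall>g\<in>vecs d. fst (A gs) \<le> fst (A (gs @ [g]))))"

definition delayed_oracle :: "real \<Rightarrow> (vec \<Rightarrow> real \<Rightarrow> vec) \<Rightarrow> real \<Rightarrow> vec
    \<Rightarrow> real \<times> vec \<times> bool \<Rightarrow> real \<Rightarrow> (real \<times> vec \<times> bool) \<times> vec" where
  "delayed_oracle \<tau> G t x s \<xi> = (case s of (st, sx, sq) \<Rightarrow>
      if \<not> sq then ((t, x, True), vzero)
      else if t < st + \<tau> then ((st, sx, True), vzero)
      else ((0, vzero, False), G sx \<xi>))"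

text \<open>The protocol, driven by an array omega of samples: the (k+1)-th draw from oracle i
  is omega (i, k+1); under the product measure below all omega (i,k) are independent with
  omega (i,k) ~ D i.  Returns the oracle states and the list [g^1,...,g^k].\<close>
fun run :: "alg \<Rightarrow> (nat \<Rightarrow> real) \<Rightarrow> (vec \<Rightarrow> real \<Rightarrow> vec) \<Rightarrow> (nat \<times> nat \<Rightarrow> real) \<Rightarrow> nat
    \<Rightarrow> (nat \<Rightarrow> real \<times> vec \<times> bool) \<times> vec list" where
  "run A \<tau> G \<omega> 0 = ((\<lambda>_. (0, vzero, False)), [])"
| "run A \<tau> G \<omega> (Suc k) =
     (let (st, gs) = run A \<tau> G \<omega> k;
          (t, i, x) = A gs;
          (s', g) = delayed_oracle (\<tau> i) G t x (st i) (\<omega> (i, Suc k))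
      in (st(i := s'), gs @ [g]))"

definition grads :: "alg \<Rightarrow> (nat \<Rightarrow> real) \<Rightarrow> (vec \<Rightarrow> real \<Rightarrow> vec) \<Rightarrow> (nat \<times> nat \<Rightarrow> real) \<Rightarrow> nat \<Rightarrow> vec list" where
  "grads A \<tau> G \<omega> k = snd (run A \<tau> G \<omega> k)"

definition time_seq :: "alg \<Rightarrow> (nat \<Rightarrow> real) \<Rightarrow> (vec \<Rightarrow> real \<Rightarrow> vec) \<Rightarrow> (nat \<times> nat \<Rightarrow> real) \<Rightarrow> nat \<Rightarrow> real" where
  "time_seq A \<tau> G \<omega> k = (if k = 0 then 0 else fst (A (grads A \<tau> G \<omega> (k - 1))))"

definition point_seq :: "alg \<Rightarrow> (nat \<Rightarrow> real) \<Rightarrow> (vec \<Rightarrow> real \<Rightarrow> vec) \<Rightarrow> (nat \<times> nat \<Rightarrow> real) \<Rightarrow> nat \<Rightarrow> vec" where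
  "point_seq A \<tau> G \<omega> k = snd (snd (A (grads A \<tau> G \<omega> k)))"

definition S_set :: "alg \<Rightarrow> (nat \<Rightarrow> real) \<Rightarrow> (vec \<Rightarrow> real \<Rightarrow> vec) \<Rightarrow> (nat \<times> nat \<Rightarrow> real) \<Rightarrow> real \<Rightarrow> nat set" where
  "S_set A \<tau> G \<omega> t = {k. time_seq A \<tau> G \<omega> k \<le> t}"

definition xi_space :: "nat \<Rightarrow> (nat \<Rightarrow> real measure) \<Rightarrow> ((nat \<times> nat) \<Rightarrow> real) measure" where
  "xi_space n D = PiM ({1..n} \<times> UNIV) (\<lambda>(i, k). D i)"

end

(* The hard function is c times the Moreau-smoothed maximum of the shifted coordinates x_i - mu i,
   i < d, i.e. the maximum of <w, v> - mu/2 |w|^2 over the probability simplex, v_i = x_i - mu i.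
   Its gradient, c times the optimal w, is c/mu-Lipschitz and bounded by c, and reveals at most one
   new coordinate per query.  With d ~ min (sqrt L R / sqrt eps) (M^2 R^2 / eps^2),
   c ~ eps sqrt d / R and mu ~ R / d^(3/2) it serves both regimes of the minimum at once, and as long
   as one coordinate is unseen, the suboptimality is at least 5/2 eps.  The stochastic oracle
   reveals the new coordinate only with probability p ~ min 1 (c^2 / sigma^2).  Call the phase
   between two reveals short if its length is below delta: a computation can end a short phase
   only if it starts and finishes inside it, so at most sum_i floor (delta / tau_i) computations per
   phase get a chance.  For delta ~ min_m (m + 1/p) / (sum_{i <= m} 1 / tau_i) this makes the expected
   number of short phases at most d/4, and Markov's inequality gives time d delta / 2 with
   probability 1/2. *)

theory Submission
  imports Defs
begin

section \<open>Euclidean geometry of \<open>vecs d\<close> and uniqueness of gradients\<close>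

section \<open>Vectors\<close>

lemma vnorm_eq_L2_set: "vnorm d x = L2_set x {..<d}"
  by (simp add: vnorm_def vinner_def L2_set_def power2_eq_square)

lemma vnorm_nonneg [simp]: "0 \<le> vnorm d x"
  by (simp add: vnorm_eq_L2_set)

lemma vinner_self: "vinner d x x = (vnorm d x)\<^sup>2"
  by (simp add: vnorm_def vinner_def sum_nonneg)

lemma abs_vinner_le: "\<bar>vinner d x y\<bar> \<le> vnorm d x * vnorm d y"
proof -
  have "\<bar>vinner d x y\<bar> \<le> (\<Sum>i<d. \<bar>x i\<bar> * \<bar>y i\<bar>)"
    unfolding vinner_def by (rule order_trans[OF sum_abs]) (simp add: abs_mult)
  also have "\<dots> \<le> vnorm d x * vnorm d y"
    unfolding vnorm_eq_L2_set by (rule L2_set_mult_ineq)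
  finally show ?thesis .
qed

lemma abs_le_vnorm: "i < d \<Longrightarrow> \<bar>x i\<bar> \<le> vnorm d x"
  using member_le_L2_set[of "{..<d}" i "\<lambda>i. \<bar>x i\<bar>"]
  by (simp add: vnorm_eq_L2_set) (simp add: L2_set_def)

lemma vnorm_scale: "vnorm d (\<lambda>i. c * x i) = \<bar>c\<bar> * vnorm d x"
  by (simp add: vnorm_def vinner_def power2_eq_square[symmetric] power_mult_distrib
      sum_distrib_left[symmetric] real_sqrt_mult)

lemma vnorm_diff_commute: "vnorm d (\<lambda>i. x i - y i) = vnorm d (\<lambda>i. y i - x i)"
  by (simp add: vnorm_def vinner_def power2_eq_square[symmetric] power2_commute)

lemma vnorm_eq_0_imp: "vnorm d x = 0 \<Longrightarrow> x \<in> vecs d \<Longrightarrow> x = vzero"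
  unfolding vecs_def vzero_def vnorm_eq_L2_set
  by (auto simp: L2_set_eq_0_iff fun_eq_iff) (metis lessThan_iff not_less)

lemma vinner_scale_right: "vinner d x (\<lambda>i. c * y i) = c * vinner d x y"
  by (simp add: vinner_def sum_distrib_left mult_ac)

lemma vinner_scale_left: "vinner d (\<lambda>i. c * x i) y = c * vinner d x y"
  by (simp add: vinner_def sum_distrib_left mult_ac)

lemma vinner_diff_left: "vinner d (\<lambda>i. x i - y i) z = vinner d x z - vinner d y z"
  by (simp add: vinner_def sum_subtractf algebra_simps)

text \<open>Along \<open>u = g - h\<close> the two linear models differ by \<open>s\<close> times
  the squared norm of \<open>u\<close>, while each approximates \<open>f\<close> up to
  \<open>e * s * vnorm d u\<close>; \<open>e = vnorm d u / 4\<close> makes this impossible. It ties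
  the choice operator in \<open>vgrad\<close> to explicit gradients.\<close>

lemma has_grad_unique:
  assumes g: "has_grad d f g x" and h: "has_grad d f h x"
    and vecs: "g \<in> vecs d" "h \<in> vecs d" "x \<in> vecs d"
  shows "g = h"
proof (rule ccontr)
  assume "g \<noteq> h"
  define u where "u = (\<lambda>i. g i - h i)"
  have uv: "u \<in> vecs d" using vecs by (auto simp: u_def vecs_def)
  have "u \<noteq> vzero" using \<open>g \<noteq> h\<close> by (auto simp: u_def vzero_def fun_eq_iff)
  then have pos: "vnorm d u > 0"
    using vnorm_eq_0_imp[OF _ uv] vnorm_nonneg[of d u] by (metis order.not_eq_order_implies_strict)
  define e where "e = vnorm d u / 4"
  have "e > 0" using pos by (simp add: e_def)
  from g[unfolded has_grad_def, rule_format, OF this] obtain a where a: "a > 0"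
    "\<And>y. y \<in> vecs d \<Longrightarrow> vnorm d (\<lambda>j. y j - x j) < a \<Longrightarrow>
      \<bar>f y - f x - vinner d g (\<lambda>j. y j - x j)\<bar> \<le> e * vnorm d (\<lambda>j. y j - x j)" by blast
  from h[unfolded has_grad_def, rule_format, OF \<open>e > 0\<close>] obtain b where b: "b > 0"
    "\<And>y. y \<in> vecs d \<Longrightarrow> vnorm d (\<lambda>j. y j - x j) < b \<Longrightarrow>
      \<bar>f y - f x - vinner d h (\<lambda>j. y j - x j)\<bar> \<le> e * vnorm d (\<lambda>j. y j - x j)" by blast
  define s where "s = min a b / (2 * vnorm d u)"
  have s: "s > 0" using a(1) b(1) pos by (simp add: s_def)
  define y where "y = (\<lambda>i. x i + s * u i)"
  have yv: "y \<in> vecs d" using uv vecs by (auto simp: y_def vecs_def)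
  have yx: "(\<lambda>j. y j - x j) = (\<lambda>j. s * u j)" by (simp add: y_def)
  have ny: "vnorm d (\<lambda>j. y j - x j) = s * vnorm d u"
    unfolding yx using s by (simp add: vnorm_scale)
  have "s * vnorm d u = min a b / 2" using pos by (simp add: s_def)
  then have lt: "s * vnorm d u < a" "s * vnorm d u < b" using a(1) b(1) by auto
  have 1: "\<bar>f y - f x - vinner d g (\<lambda>j. y j - x j)\<bar> \<le> e * (s * vnorm d u)"
    using a(2)[OF yv] lt ny by simp
  have 2: "\<bar>f y - f x - vinner d h (\<lambda>j. y j - x j)\<bar> \<le> e * (s * vnorm d u)"
    using b(2)[OF yv] lt ny by simp
  have "vinner d g (\<lambda>j. y j - x j) - vinner d h (\<lambda>j. y j - x j) = s * (vnorm d u)\<^sup>2"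
    unfolding vinner_diff_left[symmetric] yx vinner_scale_right vinner_self[symmetric]
    by (simp add: right_diff_distrib[symmetric] vinner_diff_left[symmetric] u_def)
  with 1 2 have "s * (vnorm d u)\<^sup>2 \<le> 2 * (e * (s * vnorm d u))" by linarith
  then have "s * (vnorm d u)\<^sup>2 \<le> s * (vnorm d u)\<^sup>2 / 2"
    by (simp add: e_def power2_eq_square)
  moreover have "s * (vnorm d u)\<^sup>2 > 0" using s pos by simp
  ultimately show False by linarith
qed

lemma vgrad_eqI:
  assumes "has_grad d f g x" "g \<in> vecs d" "x \<in> vecs d"
  shows "vgrad d f x = g"
  unfolding vgrad_def by (rule some_equality) (use assms has_grad_unique in blast)+

section \<open>Smoothing the shifted maximum by a quadratic penalty on the simplex\<close>

section \<open>The smoothed chained maximum\<close>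

definition shifted :: "real \<Rightarrow> vec \<Rightarrow> vec" where
  "shifted \<mu> x i = x i - \<mu> * real i"

text \<open>For \<open>d \<ge> 1\<close> and \<open>\<mu> > 0\<close>, the multiplier of the
  constraint that the weights sum to 1: cutting at this water level projects
  \<open>shifted \<mu> x / \<mu>\<close> onto the simplex.\<close>

definition level :: "nat \<Rightarrow> real \<Rightarrow> vec \<Rightarrow> real" where
  "level d \<mu> x = (SOME \<theta>. (\<Sum>i<d. max 0 (shifted \<mu> x i - \<theta>)) = \<mu>)"

definition weights :: "nat \<Rightarrow> real \<Rightarrow> vec \<Rightarrow> vec" where
  "weights d \<mu> x i = (if i < d then max 0 (shifted \<mu> x i - level d \<mu> x) / \<mu> else 0)"

definition smooth_obj :: "nat \<Rightarrow> real \<Rightarrow> vec \<Rightarrow> vec \<Rightarrow> real" where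
  "smooth_obj d \<mu> u x = vinner d u (shifted \<mu> x) - \<mu> / 2 * vinner d u u"

definition smooth_max :: "nat \<Rightarrow> real \<Rightarrow> vec \<Rightarrow> real" where
  "smooth_max d \<mu> x = smooth_obj d \<mu> (weights d \<mu> x) x"

definition prob_simplex :: "nat \<Rightarrow> vec set" where
  "prob_simplex d = {u \<in> vecs d. (\<forall>i. 0 \<le> u i) \<and> (\<Sum>i<d. u i) = 1}"

text \<open>Intermediate value theorem: the total excess over \<open>\<theta>\<close> is continuous,
  vanishes above all coordinates, and at \<open>v 0 - \<mu>\<close> coordinate 0 alone contributes
  \<open>\<mu>\<close>.\<close>

lemma level_exists:
  fixes v :: vec
  assumes "d \<ge> 1" "\<mu> > 0"
  shows "\<exists>\<theta>::real. (\<Sum>i<d. max 0 (v i - \<theta>)) = \<mu>"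
proof -
  let ?F = "\<lambda>\<theta>::real. (\<Sum>i<d. max 0 (v i - \<theta>))"
  define a where "a = v 0 - \<mu>"
  define b where "b = max a (Max (v ` {..<d}))"
  have le: "a \<le> b" by (simp add: b_def)
  have "v i \<le> b" if "i < d" for i
    unfolding b_def using that by (intro max.coboundedI2 Max_ge) auto
  then have "?F b = 0" by (intro sum.neutral) (auto simp: max_absorb1)
  moreover have "max 0 (v 0 - a) \<le> ?F a"
    using assms by (intro member_le_sum) auto
  then have "\<mu> \<le> ?F a" using assms by (simp add: a_def)
  moreover have "continuous_on {a..b} ?F" by (intro continuous_intros)
  ultimately show ?thesis
    using IVT2'[of ?F b \<mu> a] le assms by auto
qed

lemma level_sum:
  assumes "d \<ge> 1" "\<mu> > 0"
  shows "(\<Sum>i<d. max 0 (shifted \<mu> x i - level d \<mu> x)) = \<mu>"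
  unfolding level_def by (rule someI_ex, rule level_exists[OF assms])

lemma weights_in_vecs [simp]: "weights d \<mu> x \<in> vecs d"
  by (auto simp: vecs_def weights_def)

lemma simplex_vnorm_le_1:
  assumes "u \<in> prob_simplex d" shows "vnorm d u \<le> 1"
proof -
  have u: "u i \<ge> 0" "(\<Sum>i<d. u i) = 1" for i using assms by (auto simp: prob_simplex_def)
  have "u i \<le> 1" if "i < d" for i
    using member_le_sum[of i "{..<d}" u] that u by auto
  then have "(\<Sum>i<d. u i * u i) \<le> (\<Sum>i<d. u i)"
    by (intro sum_mono) (simp add: mult_left_le u)
  then show ?thesis using u by (simp add: vnorm_def vinner_def)
qed

context
  fixes d :: nat and \<mu> :: real
  assumes d: "d \<ge> 1" and \<mu>: "\<mu> > 0"
begin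

lemma weights_simplex: "weights d \<mu> x \<in> prob_simplex d"
proof -
  have "(\<Sum>i<d. weights d \<mu> x i) = (\<Sum>i<d. max 0 (shifted \<mu> x i - level d \<mu> x)) / \<mu>"
    by (simp add: weights_def sum_divide_distrib)
  then show ?thesis using level_sum[OF d \<mu>] \<mu>
    by (auto simp: prob_simplex_def) (auto simp: weights_def)
qed

lemma weights_nonneg: "0 \<le> weights d \<mu> x i"
  using weights_simplex by (auto simp: prob_simplex_def)

lemma weights_le_1: "weights d \<mu> x i \<le> 1"
  using simplex_vnorm_le_1[OF weights_simplex, of x] abs_le_vnorm[of i d "weights d \<mu> x"]
  by (cases "i < d") (force, simp add: weights_def)

text \<open>First-order optimality. The residual is the minimum of the shifted coordinate and the
  level, and equals the level where the weight is positive. Both weight vectors have mass 1, so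
  averaging it by \<open>u\<close> gives at most the level, by the optimal weights exactly the
  level.\<close>

lemma weights_optimal:
  assumes "u \<in> prob_simplex d"
  shows "vinner d (\<lambda>i. u i - weights d \<mu> x i) (\<lambda>i. shifted \<mu> x i - \<mu> * weights d \<mu> x i) \<le> 0"
proof -
  let ?w = "weights d \<mu> x" and ?r = "\<lambda>i. shifted \<mu> x i - \<mu> * weights d \<mu> x i"
  let ?t = "level d \<mu> x"
  have r: "?r i = min (shifted \<mu> x i) ?t" if "i < d" for i
    using that \<mu> by (auto simp: weights_def max_def min_def)
  have wr: "?w i * ?r i = ?w i * ?t" if "i < d" for i
    using that r[OF that] by (auto simp: weights_def)
  have "(\<Sum>i<d. u i * ?r i) \<le> (\<Sum>i<d. u i * ?t)"
    using assms by (intro sum_mono mult_left_mono) (auto simp: r prob_simplex_def)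
  also have "\<dots> = (\<Sum>i<d. ?w i * ?t)"
    using assms weights_simplex by (simp add: sum_distrib_right[symmetric] prob_simplex_def)
  also have "\<dots> = (\<Sum>i<d. ?w i * ?r i)" by (intro sum.cong) (auto simp: wr)
  finally show ?thesis by (simp add: vinner_def left_diff_distrib sum_subtractf)
qed

text \<open>The objective is a concave quadratic in the weights, so the expansion around the
  optimiser is exact: the loss is minus the term in \<open>weights_optimal\<close> plus a
  square.\<close>

lemma smooth_obj_le_smooth_max:
  assumes "u \<in> prob_simplex d"
  shows "smooth_obj d \<mu> u x \<le> smooth_max d \<mu> x"
proof -
  let ?w = "weights d \<mu> x" and ?v = "shifted \<mu> x"
  have "smooth_max d \<mu> x - smooth_obj d \<mu> u x =
    - vinner d (\<lambda>i. u i - ?w i) (\<lambda>i. ?v i - \<mu> * ?w i) +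
      \<mu> / 2 * vinner d (\<lambda>i. u i - ?w i) (\<lambda>i. u i - ?w i)"
    unfolding smooth_max_def smooth_obj_def vinner_def sum_distrib_left
      sum_subtractf[symmetric] sum_negf[symmetric] sum.distrib[symmetric]
    by (intro sum.cong) (auto simp: field_simps)
  moreover have "\<mu> / 2 * vinner d (\<lambda>i. u i - ?w i) (\<lambda>i. u i - ?w i) \<ge> 0"
    using \<mu> by (simp add: vinner_self)
  ultimately show ?thesis using weights_optimal[OF assms, of x] by linarith
qed

lemma smooth_obj_diff:
  "smooth_obj d \<mu> u y - smooth_obj d \<mu> u x = vinner d u (\<lambda>i. y i - x i)"
  unfolding smooth_obj_def vinner_def
  by (simp add: sum_subtractf[symmetric] shifted_def algebra_simps)

text \<open>The weights optimal at \<open>x\<close> stay feasible at \<open>y\<close>, and for fixed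
  weights the objective is affine in the point.\<close>

lemma smooth_max_subgradient:
  "vinner d (weights d \<mu> x) (\<lambda>i. y i - x i) \<le> smooth_max d \<mu> y - smooth_max d \<mu> x"
  using smooth_obj_le_smooth_max[OF weights_simplex[of x], of y]
    smooth_obj_diff[of "weights d \<mu> x" y x] by (simp add: smooth_max_def)

text \<open>Each weight vector is tested in the optimality condition of the other; the sum bounds
  \<open>\<mu>\<close> times the squared norm of \<open>?D\<close> by its inner product with
  \<open>x - y\<close>, and Cauchy-Schwarz finishes.\<close>

lemma weights_lipschitz:
  "vnorm d (\<lambda>i. weights d \<mu> x i - weights d \<mu> y i) \<le> vnorm d (\<lambda>i. x i - y i) / \<mu>"
proof -
  let ?wx = "weights d \<mu> x" and ?wy = "weights d \<mu> y"
  let ?D = "\<lambda>i. ?wx i - ?wy i"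
  have 1: "vinner d (\<lambda>i. ?wy i - ?wx i) (\<lambda>i. shifted \<mu> x i - \<mu> * ?wx i) \<le> 0"
    by (rule weights_optimal[OF weights_simplex])
  have 2: "vinner d ?D (\<lambda>i. shifted \<mu> y i - \<mu> * ?wy i) \<le> 0"
    by (rule weights_optimal[OF weights_simplex])
  have "vinner d (\<lambda>i. ?wy i - ?wx i) (\<lambda>i. shifted \<mu> x i - \<mu> * ?wx i) +
      vinner d ?D (\<lambda>i. shifted \<mu> y i - \<mu> * ?wy i)
      = \<mu> * vinner d ?D ?D - vinner d ?D (\<lambda>i. x i - y i)"
    unfolding vinner_def sum_distrib_left sum_subtractf[symmetric] sum.distrib[symmetric]
    by (intro sum.cong) (auto simp: shifted_def algebra_simps)
  with 1 2 have "\<mu> * (vnorm d ?D)\<^sup>2 \<le> vinner d ?D (\<lambda>i. x i - y i)"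
    by (simp add: vinner_self)
  also have "\<dots> \<le> vnorm d ?D * vnorm d (\<lambda>i. x i - y i)"
    using abs_vinner_le abs_le_D1 by blast
  finally have *: "vnorm d ?D * (\<mu> * vnorm d ?D) \<le> vnorm d ?D * vnorm d (\<lambda>i. x i - y i)"
    by (simp add: power2_eq_square mult_ac)
  show ?thesis
  proof (cases "vnorm d ?D = 0")
    case False
    then have "vnorm d ?D > 0" by (simp add: order.not_eq_order_implies_strict)
    with * show ?thesis using \<mu> by (simp add: field_simps)
  qed (use \<mu> in auto)
qed

lemma smooth_max_lipschitz:
  "\<bar>smooth_max d \<mu> x - smooth_max d \<mu> y\<bar> \<le> vnorm d (\<lambda>i. x i - y i)"
proof -
  have *: "smooth_max d \<mu> a - smooth_max d \<mu> b \<le> vnorm d (\<lambda>i. a i - b i)" for a b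
  proof -
    have "smooth_max d \<mu> a - smooth_max d \<mu> b \<le> - vinner d (weights d \<mu> a) (\<lambda>i. b i - a i)"
      using smooth_max_subgradient[of a b] by simp
    also have "\<dots> \<le> vnorm d (weights d \<mu> a) * vnorm d (\<lambda>i. b i - a i)"
      using abs_vinner_le abs_le_D2 by blast
    also have "\<dots> \<le> 1 * vnorm d (\<lambda>i. b i - a i)"
      by (intro mult_right_mono simplex_vnorm_le_1 weights_simplex) simp
    finally show ?thesis using vnorm_diff_commute[of d a b] by simp
  qed
  show ?thesis using *[of x y] *[of y x] vnorm_diff_commute[of d x y] by auto
qed

text \<open>The subgradient inequality at \<open>x\<close> makes the linearisation error
  nonnegative; the one at \<open>y\<close> bounds it by the change of weights against
  \<open>y - x\<close>, which is quadratic in the distance.\<close>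

lemma has_grad_smooth_max:
  "has_grad d (\<lambda>x. c * smooth_max d \<mu> x) (\<lambda>i. c * weights d \<mu> x i) x"
  unfolding has_grad_def
proof (intro allI impI)
  fix e :: real assume e: "e > 0"
  \<comment> \<open>Makes the quadratic error linear with slope \<open>e\<close>; the summand 1 also
    covers \<open>c = 0\<close>.\<close>
  define \<delta> where "\<delta> = e * \<mu> / (\<bar>c\<bar> + 1)"
  have \<delta>: "\<delta> > 0" using e \<mu> by (simp add: \<delta>_def add_nonneg_pos)
  have "\<bar>c * smooth_max d \<mu> y - c * smooth_max d \<mu> x
      - vinner d (\<lambda>i. c * weights d \<mu> x i) (\<lambda>j. y j - x j)\<bar> \<le> e * vnorm d (\<lambda>j. y j - x j)"
    if lt: "vnorm d (\<lambda>j. y j - x j) < \<delta>" for y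
  proof -
    let ?n = "vnorm d (\<lambda>j. y j - x j)"
    define E where "E = smooth_max d \<mu> y - smooth_max d \<mu> x - vinner d (weights d \<mu> x) (\<lambda>j. y j - x j)"
    have E0: "E \<ge> 0" using smooth_max_subgradient[of x y] by (simp add: E_def)
    have neg: "vinner d (weights d \<mu> y) (\<lambda>j. x j - y j) = - vinner d (weights d \<mu> y) (\<lambda>j. y j - x j)"
      by (simp add: vinner_def sum_negf[symmetric] algebra_simps)
    have "E \<le> vinner d (\<lambda>i. weights d \<mu> y i - weights d \<mu> x i) (\<lambda>j. y j - x j)"
      using smooth_max_subgradient[of y x] by (simp add: E_def vinner_diff_left neg)
    also have "\<dots> \<le> vnorm d (\<lambda>i. weights d \<mu> y i - weights d \<mu> x i) * ?n"
      using abs_vinner_le abs_le_D1 by blast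
    also have "\<dots> \<le> ?n / \<mu> * ?n"
      by (intro mult_right_mono weights_lipschitz) simp
    also have "\<dots> \<le> \<delta> / \<mu> * ?n"
      using lt \<mu> by (intro mult_right_mono divide_right_mono) auto
    finally have "E \<le> e / (\<bar>c\<bar> + 1) * ?n" using \<mu> by (simp add: \<delta>_def)
    then have "\<bar>c\<bar> * E \<le> \<bar>c\<bar> * (e / (\<bar>c\<bar> + 1) * ?n)" by (intro mult_left_mono) auto
    also have "\<dots> = (\<bar>c\<bar> / (\<bar>c\<bar> + 1)) * (e * ?n)" by simp
    also have "\<dots> \<le> 1 * (e * ?n)" using e by (intro mult_right_mono) auto
    finally have "\<bar>c * E\<bar> \<le> e * ?n" using E0 by (simp add: abs_mult)
    moreover have "c * smooth_max d \<mu> y - c * smooth_max d \<mu> x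
      - vinner d (\<lambda>i. c * weights d \<mu> x i) (\<lambda>j. y j - x j) = c * E"
      by (simp add: E_def vinner_scale_left algebra_simps)
    ultimately show ?thesis by simp
  qed
  then show "\<exists>\<delta>>0. \<forall>y\<in>vecs d. vnorm d (\<lambda>j. y j - x j) < \<delta> \<longrightarrow>
      \<bar>c * smooth_max d \<mu> y - c * smooth_max d \<mu> x
        - vinner d (\<lambda>i. c * weights d \<mu> x i) (\<lambda>j. y j - x j)\<bar> \<le> e * vnorm d (\<lambda>j. y j - x j)"
    using \<delta> by blast
qed

lemma vgrad_smooth_max:
  "x \<in> vecs d \<Longrightarrow> vgrad d (\<lambda>x. c * smooth_max d \<mu> x) x = (\<lambda>i. c * weights d \<mu> x i)"
  using weights_in_vecs[of d \<mu> x]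
  by (intro vgrad_eqI has_grad_smooth_max) (auto simp: vecs_def)

text \<open>A maximum of functions affine in the point: the weights optimal at the combination are
  used at both endpoints.\<close>

lemma smooth_max_convex:
  assumes "0 \<le> u" "u \<le> 1"
  shows "smooth_max d \<mu> (\<lambda>j. u * x j + (1 - u) * y j)
    \<le> u * smooth_max d \<mu> x + (1 - u) * smooth_max d \<mu> y"
proof -
  let ?z = "\<lambda>j. u * x j + (1 - u) * y j"
  let ?w = "weights d \<mu> ?z"
  have "smooth_max d \<mu> ?z = u * smooth_obj d \<mu> ?w x + (1 - u) * smooth_obj d \<mu> ?w y"
    unfolding smooth_max_def smooth_obj_def vinner_def right_diff_distrib sum_distrib_left
      sum_subtractf[symmetric] sum.distrib[symmetric]
    by (intro sum.cong) (auto simp: shifted_def field_simps)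
  also have "\<dots> \<le> u * smooth_max d \<mu> x + (1 - u) * smooth_max d \<mu> y"
    using assms by (intro add_mono mult_left_mono smooth_obj_le_smooth_max weights_simplex) auto
  finally show ?thesis .
qed

lemma F_conv_smooth_max:
  assumes "0 \<le> c" "c \<le> M" "c / \<mu> \<le> L"
  shows "F_conv d R M L (\<lambda>x. c * smooth_max d \<mu> x)"
  unfolding F_conv_def
proof (intro conjI ballI)
  show "convex_vec d (\<lambda>x. c * smooth_max d \<mu> x)"
    unfolding convex_vec_def
  proof (intro ballI allI impI)
    fix x y u assume "0 \<le> u \<and> u \<le> (1::real)"
    from mult_left_mono[OF smooth_max_convex[of u x y] \<open>0 \<le> c\<close>] this
    show "c * smooth_max d \<mu> (\<lambda>j. u * x j + (1 - u) * y j)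
        \<le> u * (c * smooth_max d \<mu> x) + (1 - u) * (c * smooth_max d \<mu> y)"
      by (simp add: algebra_simps)
  qed
next
  fix x assume "x \<in> vecs d"
  show "differentiable_vec d (\<lambda>x. c * smooth_max d \<mu> x) x"
    unfolding differentiable_vec_def
    using has_grad_smooth_max[of c x] weights_in_vecs[of d \<mu> x]
    by (intro bexI[of _ "\<lambda>i. c * weights d \<mu> x i"]) (auto simp: vecs_def)
next
  fix x y assume xy: "x \<in> vball d R" "y \<in> vball d R"
  then have v: "x \<in> vecs d" "y \<in> vecs d" by (auto simp: vball_def)
  have "vnorm d (\<lambda>j. c * weights d \<mu> x j - c * weights d \<mu> y j)
      = c * vnorm d (\<lambda>j. weights d \<mu> x j - weights d \<mu> y j)"
    using assms(1) by (simp add: right_diff_distrib[symmetric] vnorm_scale)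
  also have "\<dots> \<le> c * (vnorm d (\<lambda>i. x i - y i) / \<mu>)"
    by (intro mult_left_mono weights_lipschitz assms)
  also have "\<dots> = (c / \<mu>) * vnorm d (\<lambda>i. x i - y i)" by simp
  also have "\<dots> \<le> L * vnorm d (\<lambda>i. x i - y i)"
    by (intro mult_right_mono assms) simp
  finally show "vnorm d (\<lambda>j. vgrad d (\<lambda>x. c * smooth_max d \<mu> x) x j
      - vgrad d (\<lambda>x. c * smooth_max d \<mu> x) y j) \<le> L * vnorm d (\<lambda>j. x j - y j)"
    by (simp add: vgrad_smooth_max v)
  have "\<bar>c * smooth_max d \<mu> x - c * smooth_max d \<mu> y\<bar> = c * \<bar>smooth_max d \<mu> x - smooth_max d \<mu> y\<bar>"
    using assms(1) by (simp add: right_diff_distrib[symmetric] abs_mult)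
  also have "\<dots> \<le> M * vnorm d (\<lambda>j. x j - y j)"
    using assms by (intro mult_mono smooth_max_lipschitz) auto
  finally show "\<bar>c * smooth_max d \<mu> x - c * smooth_max d \<mu> y\<bar> \<le> M * vnorm d (\<lambda>j. x j - y j)" .
qed

text \<open>Consecutive offsets differ by the total excess \<open>\<mu>\<close> over the level, so among equal
  coordinates only the first can be above the level.\<close>

lemma weights_zero_chain:
  assumes "\<And>i. i \<ge> j \<Longrightarrow> x i = 0" "i > j"
  shows "weights d \<mu> x i = 0"
proof (rule ccontr)
  let ?e = "\<lambda>i. max 0 (shifted \<mu> x i - level d \<mu> x)"
  assume "weights d \<mu> x i \<noteq> 0"
  then have i: "i < d" "shifted \<mu> x i > level d \<mu> x" by (auto simp: weights_def split: if_splits)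
  have "real i - real j \<ge> 1" using assms(2) by auto
  then have "\<mu> * (real i - real j) \<ge> \<mu>" using \<mu> by simp
  then have "shifted \<mu> x j \<ge> shifted \<mu> x i + \<mu>"
    using assms by (simp add: shifted_def algebra_simps)
  then have "?e j > \<mu>" using i \<mu> by auto
  moreover have "?e j \<le> (\<Sum>i<d. ?e i)"
    using i assms(2) by (intro member_le_sum) auto
  ultimately show False using level_sum[OF d \<mu>, of x] by linarith
qed

text \<open>Tested with vertex \<open>i\<close> of the simplex: offset and penalty cost at most
  \<open>\<mu> * d\<close>. With \<open>x i = 0\<close> this bounds the value while a coordinate is
  unseen.\<close>

lemma smooth_max_ge_of_coord:
  assumes "i < d" shows "smooth_max d \<mu> x \<ge> x i - \<mu> * real d"
proof -
  define u :: vec where "u = (\<lambda>k. if k = i then 1 else 0)"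
  have u: "u \<in> prob_simplex d" using assms by (auto simp: prob_simplex_def u_def vecs_def sum.delta)
  have "vinner d u z = z i" for z using assms
    unfolding vinner_def u_def by (simp add: if_distrib[of "\<lambda>a. a * _"] sum.delta cong: if_cong)
  then have "smooth_obj d \<mu> u x = x i - \<mu> * real i - \<mu> / 2"
    unfolding smooth_obj_def by (simp add: shifted_def) (simp add: u_def)
  moreover have "\<mu> * (real i + 1) \<le> \<mu> * real d"
    using \<mu> assms by (intro mult_left_mono) auto
  ultimately show ?thesis
    using smooth_obj_le_smooth_max[OF u, of x] \<mu> by (simp add: algebra_simps)
qed

lemma smooth_max_le:
  assumes "\<And>i. i < d \<Longrightarrow> x i \<le> a" shows "smooth_max d \<mu> x \<le> a"
proof -
  let ?w = "weights d \<mu> x"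
  have "vinner d ?w (shifted \<mu> x) \<le> (\<Sum>i<d. ?w i * a)"
    unfolding vinner_def
  proof (intro sum_mono mult_left_mono weights_nonneg)
    fix i assume "i \<in> {..<d}"
    then show "shifted \<mu> x i \<le> a"
      using assms[of i] mult_nonneg_nonneg[OF less_imp_le[OF \<mu>] of_nat_0_le_iff[of i]]
      unfolding shifted_def by auto
  qed
  also have "\<dots> = a"
    using weights_simplex[of x] by (simp add: sum_distrib_right[symmetric] prob_simplex_def)
  finally have "vinner d ?w (shifted \<mu> x) \<le> a" .
  moreover have "\<mu> / 2 * vinner d ?w ?w \<ge> 0" using \<mu> by (simp add: vinner_self)
  ultimately show ?thesis unfolding smooth_max_def smooth_obj_def by linarith
qed

lemma Inf_smooth_max_le:
  assumes "c \<ge> 0" "R > 0"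
  shows "(INF x\<in>vball d R. c * smooth_max d \<mu> x) \<le> - (c * (R / sqrt d))"
proof -
  define y :: vec where "y = (\<lambda>i. if i < d then - R / sqrt d else 0)"
  have "vnorm d y = R"
    using d assms by (simp add: y_def vnorm_def vinner_def real_sqrt_divide)
  then have y: "y \<in> vball d R" by (auto simp: vball_def vecs_def y_def)
  \<comment> \<open>A real infimum is below the value at the witness only if the values are bounded
    below; coordinate 0 provides the bound.\<close>
  have bdd: "bdd_below ((\<lambda>x. c * smooth_max d \<mu> x) ` vball d R)"
  proof (rule bdd_belowI2)
    fix x assume "x \<in> vball d R"
    then have "x 0 \<ge> - R" using abs_le_vnorm[of 0 d x] d by (auto simp: vball_def)
    then show "c * (- R - \<mu> * real d) \<le> c * smooth_max d \<mu> x"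
      using smooth_max_ge_of_coord[of 0 x] d assms by (intro mult_left_mono) auto
  qed
  have "(INF x\<in>vball d R. c * smooth_max d \<mu> x) \<le> c * smooth_max d \<mu> y"
    by (rule cINF_lower[OF bdd y])
  also have "\<dots> \<le> c * (- (R / sqrt d))"
    by (intro mult_left_mono smooth_max_le assms) (simp add: y_def)
  finally show ?thesis by simp
qed

end

section \<open>Progress of a run and an amortised count of eligible steps\<close>

section \<open>Progress of zero-respecting algorithms\<close>

text \<open>With coordinates counted from 0, the value is also the index of the next coordinate to
  reveal. A single vector is measured as a singleton list.\<close>

definition prog :: "vec list \<Rightarrow> nat" where
  "prog gs = (LEAST j. \<forall>g\<in>set gs. \<forall>i\<ge>j. g i = 0)"

lemma prog_le_iff:
  assumes "set gs \<subseteq> vecs d"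
  shows "prog gs \<le> j \<longleftrightarrow> (\<forall>g\<in>set gs. \<forall>i\<ge>j. g i = 0)"
proof
  assume "prog gs \<le> j"
  have "\<forall>g\<in>set gs. \<forall>i\<ge>d. g i = 0" using assms by (auto simp: vecs_def)
  then have "\<forall>g\<in>set gs. \<forall>i\<ge>prog gs. g i = 0" unfolding prog_def by (rule LeastI)
  with \<open>prog gs \<le> j\<close> show "\<forall>g\<in>set gs. \<forall>i\<ge>j. g i = 0" by auto
qed (auto simp: prog_def intro: Least_le)

lemma prog_le_dim: "set gs \<subseteq> vecs d \<Longrightarrow> prog gs \<le> d"
  by (auto simp: prog_le_iff vecs_def)

lemma prog_snoc:
  assumes "set gs \<subseteq> vecs d" "g \<in> vecs d"
  shows "prog (gs @ [g]) = max (prog gs) (prog [g])"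
proof -
  have "prog (gs @ [g]) \<le> j \<longleftrightarrow> max (prog gs) (prog [g]) \<le> j" for j
    using assms prog_le_iff[of gs d j] prog_le_iff[of "[g]" d j] prog_le_iff[of "gs @ [g]" d j]
    by auto
  then show ?thesis by (metis order_antisym order_refl)
qed

lemma prog_Nil [simp]: "prog [] = 0"
  by (simp add: prog_def)

lemma prog_vzero [simp]: "prog [vzero] = 0"
  by (simp add: prog_def vzero_def)

lemma prog_single_le_iff: "x \<in> vecs d \<Longrightarrow> prog [x] \<le> j \<longleftrightarrow> (\<forall>i\<ge>j. x i = 0)"
  by (subst prog_le_iff[where d = d]) auto

lemma zero_above_prog: "x \<in> vecs d \<Longrightarrow> prog [x] \<le> i \<Longrightarrow> x i = 0"
  using prog_single_le_iff by blast

text \<open>Collects what the counting uses of the oracle: noise enters only through the bit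
  \<open>\<xi> = 1\<close>, and a reply exceeds the progress of its point by at most one, and only
  if the bit is set.\<close>

locale chain_run =
  fixes n d :: nat and R \<delta> :: real and A :: alg and \<tau> :: "nat \<Rightarrow> real" and G :: "vec \<Rightarrow> real \<Rightarrow> vec"
  assumes alg: "alg_zr n d R A"
    and tau_pos: "\<And>i. i \<in> {1..n} \<Longrightarrow> \<tau> i > 0"
    and delta_pos: "\<delta> > 0"
    and G_vecs: "\<And>x \<xi>. G x \<xi> \<in> vecs d"
    and G_bit: "\<And>x \<xi> \<xi>'. (\<xi> = 1) = (\<xi>' = 1) \<Longrightarrow> G x \<xi> = G x \<xi>'"
    and G_chain: "\<And>x \<xi>. x \<in> vecs d \<Longrightarrow> prog [G x \<xi>] \<le> Suc (prog [x])"
    and G_silent: "\<And>x \<xi>. x \<in> vecs d \<Longrightarrow> \<xi> \<noteq> 1 \<Longrightarrow> prog [G x \<xi>] \<le> prog [x]"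
begin

abbreviation gr where "gr \<omega> k \<equiv> grads A \<tau> G \<omega> k"
abbreviation tseq where "tseq \<omega> k \<equiv> time_seq A \<tau> G \<omega> k"

definition state :: "(nat \<times> nat \<Rightarrow> real) \<Rightarrow> nat \<Rightarrow> nat \<Rightarrow> real \<times> vec \<times> bool" where
  "state \<omega> k = fst (run A \<tau> G \<omega> k)"
text \<open>Step \<open>k\<close> carries the protocol data numbered \<open>k + 1\<close>: this
  oracle, the time \<open>tseq \<omega> (Suc k)\<close> and the sample \<open>Suc k\<close>.\<close>

definition idx :: "(nat \<times> nat \<Rightarrow> real) \<Rightarrow> nat \<Rightarrow> nat" where
  "idx \<omega> k = fst (snd (A (gr \<omega> k)))"
definition P :: "(nat \<times> nat \<Rightarrow> real) \<Rightarrow> nat \<Rightarrow> nat" where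
  "P \<omega> k = prog (gr \<omega> k)"
definition reply :: "(nat \<times> nat \<Rightarrow> real) \<Rightarrow> nat \<Rightarrow> (real \<times> vec \<times> bool) \<times> vec" where
  "reply \<omega> k = delayed_oracle (\<tau> (idx \<omega> k)) G (tseq \<omega> (Suc k)) (point_seq A \<tau> G \<omega> k)
     (state \<omega> k (idx \<omega> k)) (\<omega> (idx \<omega> k, Suc k))"

text \<open>Start of the current phase; time 0 opens the first one.\<close>

primrec last_reveal :: "(nat \<times> nat \<Rightarrow> real) \<Rightarrow> nat \<Rightarrow> real" where
  "last_reveal \<omega> 0 = 0"
| "last_reveal \<omega> (Suc k) = (if P \<omega> (Suc k) = P \<omega> k then last_reveal \<omega> k else tseq \<omega> (Suc k))"

text \<open>A step is eligible if a computation that may reveal the next coordinate finishes less than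
  \<open>\<delta>\<close> after the last coordinate was revealed; it is a hit if it does reveal it.\<close>

definition elig :: "(nat \<times> nat \<Rightarrow> real) \<Rightarrow> nat \<Rightarrow> bool" where
  "elig \<omega> k \<longleftrightarrow> (case state \<omega> k (idx \<omega> k) of (st, sx, sq) \<Rightarrow>
     sq \<and> st + \<tau> (idx \<omega> k) \<le> tseq \<omega> (Suc k) \<and> prog [sx] = P \<omega> k) \<and> P \<omega> k < d \<and>
     tseq \<omega> (Suc k) < last_reveal \<omega> k + \<delta>"

definition hit :: "(nat \<times> nat \<Rightarrow> real) \<Rightarrow> nat \<Rightarrow> bool" where
  "hit \<omega> k \<longleftrightarrow> elig \<omega> k \<and> \<omega> (idx \<omega> k, Suc k) = 1"

text \<open>How many computations, over all oracles, fit one after another into a window of length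
  \<open>\<delta>\<close>.\<close>

definition capacity :: nat where
  "capacity = (\<Sum>i=1..n. nat \<lfloor>\<delta> / \<tau> i\<rfloor>)"

lemma state_0 [simp]: "state \<omega> 0 = (\<lambda>_. (0, vzero, False))"
  by (simp add: state_def)

lemma gr_0 [simp]: "gr \<omega> 0 = []"
  by (simp add: grads_def)

lemma P_0 [simp]: "P \<omega> 0 = 0"
  by (simp add: P_def)

lemma tseq_0 [simp]: "tseq \<omega> 0 = 0"
  by (simp add: time_seq_def)

lemma run_Suc:
  "state \<omega> (Suc k) = (state \<omega> k)(idx \<omega> k := fst (reply \<omega> k))"
  "gr \<omega> (Suc k) = gr \<omega> k @ [snd (reply \<omega> k)]"
  by (auto simp: state_def grads_def reply_def idx_def time_seq_def point_seq_def
      Let_def case_prod_beta)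

text \<open>A joint induction: the algorithm is constrained only on replies in
  \<open>vecs d\<close>, and the states store its points.\<close>

lemma gr_state_vecs: "set (gr \<omega> k) \<subseteq> vecs d \<and> (\<forall>i. fst (snd (state \<omega> k i)) \<in> vecs d)"
proof (induction k)
  case 0
  show ?case by (simp add: vecs_def vzero_def)
next
  case (Suc k)
  have "case A (gr \<omega> k) of (t, i, x) \<Rightarrow> x \<in> vball d R"
    using alg Suc unfolding alg_zr_def by (auto split: prod.splits)
  then have "point_seq A \<tau> G \<omega> k \<in> vecs d"
    by (auto simp: point_seq_def vball_def split: prod.splits)
  moreover obtain st sx sq where s: "state \<omega> k (idx \<omega> k) = (st, sx, sq)" by (metis prod_cases3)
  moreover have "sx \<in> vecs d" using Suc s by (metis fst_conv snd_conv)
  moreover have "vzero \<in> vecs d" by (simp add: vecs_def vzero_def)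
  ultimately have "snd (reply \<omega> k) \<in> vecs d \<and> fst (snd (fst (reply \<omega> k))) \<in> vecs d"
    using G_vecs by (auto simp: reply_def delayed_oracle_def)
  then show ?case using Suc by (auto simp: run_Suc)
qed

lemma gr_vecs: "set (gr \<omega> k) \<subseteq> vecs d" using gr_state_vecs by blast

lemma state_vecs: "state \<omega> k i = (st, sx, sq) \<Longrightarrow> sx \<in> vecs d"
  using gr_state_vecs by (metis fst_conv snd_conv)

lemma reply_vecs: "snd (reply \<omega> k) \<in> vecs d"
  using gr_vecs[of \<omega> "Suc k"] by (simp add: run_Suc)

lemma alg_at:
  "idx \<omega> k \<in> {1..n}" "0 \<le> tseq \<omega> (Suc k)" "point_seq A \<tau> G \<omega> k \<in> vball d R"
  "vsupp (point_seq A \<tau> G \<omega> k) \<subseteq> (\<Union>g\<in>set (gr \<omega> k). vsupp g)"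
proof -
  obtain t i x where a: "A (gr \<omega> k) = (t, i, x)" by (metis prod_cases3)
  have "t \<ge> 0 \<and> i \<in> {1..n} \<and> x \<in> vball d R \<and> vsupp x \<subseteq> (\<Union>g\<in>set (gr \<omega> k). vsupp g)"
    using alg[unfolded alg_zr_def, THEN spec, THEN mp, OF gr_vecs[of \<omega> k], THEN conjunct1]
    unfolding a by simp
  then show "idx \<omega> k \<in> {1..n}" "0 \<le> tseq \<omega> (Suc k)" "point_seq A \<tau> G \<omega> k \<in> vball d R"
    "vsupp (point_seq A \<tau> G \<omega> k) \<subseteq> (\<Union>g\<in>set (gr \<omega> k). vsupp g)"
    by (simp_all add: a idx_def time_seq_def point_seq_def)
qed

text \<open>Zero-respecting confines the support of a query to the supports of the replies so
  far.\<close>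

lemma prog_point_le: "prog [point_seq A \<tau> G \<omega> k] \<le> P \<omega> k"
proof -
  have "\<forall>g\<in>set (gr \<omega> k). \<forall>i\<ge>P \<omega> k. g i = 0"
    using prog_le_iff[OF gr_vecs] unfolding P_def by blast
  then show ?thesis
    using alg_at(3,4)[of \<omega> k]
    by (subst prog_single_le_iff[of _ d]) (auto simp: vball_def vsupp_def)
qed

lemma tseq_mono: "tseq \<omega> k \<le> tseq \<omega> (Suc k)"
proof (cases k)
  case 0
  then show ?thesis using alg_at(2)[of \<omega> 0] by simp
next
  case (Suc m)
  have "fst (A (gr \<omega> m)) \<le> fst (A (gr \<omega> m @ [snd (reply \<omega> m)]))"
    using alg gr_vecs[of \<omega> m] reply_vecs[of \<omega> m] unfolding alg_zr_def by blast
  then show ?thesis using Suc by (simp add: time_seq_def run_Suc)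
qed

lemma P_Suc: "P \<omega> (Suc k) = max (P \<omega> k) (prog [snd (reply \<omega> k)])"
  unfolding P_def run_Suc by (rule prog_snoc[OF gr_vecs reply_vecs])

lemma P_le_dim: "P \<omega> k \<le> d"
  unfolding P_def by (rule prog_le_dim[OF gr_vecs])

lemma reply_cases:
  assumes "state \<omega> k (idx \<omega> k) = (st, sx, sq)"
  obtains "\<not> sq" "reply \<omega> k = ((tseq \<omega> (Suc k), point_seq A \<tau> G \<omega> k, True), vzero)"
  | "sq" "tseq \<omega> (Suc k) < st + \<tau> (idx \<omega> k)" "reply \<omega> k = ((st, sx, True), vzero)"
  | "sq" "st + \<tau> (idx \<omega> k) \<le> tseq \<omega> (Suc k)"
    "reply \<omega> k = ((0, vzero, False), G sx (\<omega> (idx \<omega> k, Suc k)))"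
  using assms by (cases sq; cases "tseq \<omega> (Suc k) < st + \<tau> (idx \<omega> k)")
    (auto simp: reply_def delayed_oracle_def)

text \<open>The counter \<open>c i\<close> is the number of eligible steps of oracle \<open>i\<close> since the last coordinate was
  revealed.\<close>

definition invar :: "(nat \<times> nat \<Rightarrow> real) \<Rightarrow> nat \<Rightarrow> (nat \<Rightarrow> nat) \<Rightarrow> bool" where
  "invar \<omega> k c \<longleftrightarrow>
    last_reveal \<omega> k \<le> tseq \<omega> k \<and>
    \<delta> * real (P \<omega> k) \<le> last_reveal \<omega> k + \<delta> * (\<Sum>j<k. of_bool (hit \<omega> j)) \<and>
    (\<forall>i\<in>{1..n}. real (c i) * \<tau> i < \<delta> \<and> last_reveal \<omega> k + real (c i) * \<tau> i \<le> tseq \<omega> k) \<and>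
    (\<forall>i\<in>{1..n}. \<forall>st sx. state \<omega> k i = (st, sx, True) \<longrightarrow> prog [sx] \<le> P \<omega> k \<and>
        (prog [sx] = P \<omega> k \<longrightarrow> last_reveal \<omega> k + real (c i) * \<tau> i \<le> st)) \<and>
    (\<Sum>j<k. of_bool (elig \<omega> j)) \<le> capacity * P \<omega> k + (\<Sum>i=1..n. c i) \<and>
    (P \<omega> k = d \<longrightarrow> (\<forall>i. c i = 0))"

lemma invarD:
  assumes "invar \<omega> k c"
  shows "last_reveal \<omega> k \<le> tseq \<omega> k"
    "\<delta> * real (P \<omega> k) \<le> last_reveal \<omega> k + \<delta> * (\<Sum>j<k. of_bool (hit \<omega> j))"
    "i \<in> {1..n} \<Longrightarrow> real (c i) * \<tau> i < \<delta>"
    "i \<in> {1..n} \<Longrightarrow> last_reveal \<omega> k + real (c i) * \<tau> i \<le> tseq \<omega> k"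
    "i \<in> {1..n} \<Longrightarrow> state \<omega> k i = (st, sx, True) \<Longrightarrow> prog [sx] \<le> P \<omega> k"
    "i \<in> {1..n} \<Longrightarrow> state \<omega> k i = (st, sx, True) \<Longrightarrow> prog [sx] = P \<omega> k \<Longrightarrow>
      last_reveal \<omega> k + real (c i) * \<tau> i \<le> st"
    "(\<Sum>j<k. of_bool (elig \<omega> j)) \<le> capacity * P \<omega> k + (\<Sum>i=1..n. c i)"
    "P \<omega> k = d \<Longrightarrow> c i = 0"
  using assms unfolding invar_def by blast+

lemma invarI:
  assumes "last_reveal \<omega> k \<le> tseq \<omega> k"
    "\<delta> * real (P \<omega> k) \<le> last_reveal \<omega> k + \<delta> * (\<Sum>j<k. of_bool (hit \<omega> j))"
    "\<And>i. i \<in> {1..n} \<Longrightarrow> real (c i) * \<tau> i < \<delta> \<and> last_reveal \<omega> k + real (c i) * \<tau> i \<le> tseq \<omega> k"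
    "\<And>i st sx. i \<in> {1..n} \<Longrightarrow> state \<omega> k i = (st, sx, True) \<Longrightarrow> prog [sx] \<le> P \<omega> k \<and>
      (prog [sx] = P \<omega> k \<longrightarrow> last_reveal \<omega> k + real (c i) * \<tau> i \<le> st)"
    "(\<Sum>j<k. of_bool (elig \<omega> j)) \<le> capacity * P \<omega> k + (\<Sum>i=1..n. c i)"
    "\<And>i. P \<omega> k = d \<Longrightarrow> c i = 0"
  shows "invar \<omega> k c"
  using assms unfolding invar_def by blast

lemma sum_counters_le:
  assumes "\<And>i. i \<in> {1..n} \<Longrightarrow> real (c i) * \<tau> i < \<delta>"
  shows "(\<Sum>i=1..n. c i) \<le> capacity"
  unfolding capacity_def
proof (rule sum_mono)
  fix i assume i: "i \<in> {1..n}"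
  then have "real (c i) \<le> \<delta> / \<tau> i"
    using assms[OF i] tau_pos[OF i] by (simp add: field_simps)
  then show "c i \<le> nat \<lfloor>\<delta> / \<tau> i\<rfloor>" by (simp add: le_nat_floor)
qed

text \<open>A reveal ends the phase, so the counters restart at 0 and the eligible steps of the
  phase are charged to \<open>capacity\<close>.\<close>

lemma invar_Suc_new:
  assumes inv: "invar \<omega> k c" and new: "P \<omega> (Suc k) \<noteq> P \<omega> k"
  shows "invar \<omega> (Suc k) (\<lambda>_. 0)"
proof -
  obtain st sx sq where s: "state \<omega> k (idx \<omega> k) = (st, sx, sq)" by (metis prod_cases3)
  note invD = invarD[OF inv]
  from new have gt: "prog [snd (reply \<omega> k)] > P \<omega> k" by (auto simp: P_Suc max_def split: if_splits)
  \<comment> \<open>The other two replies are zero vectors, whose progress is 0.\<close>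
  have "sq \<and> st + \<tau> (idx \<omega> k) \<le> tseq \<omega> (Suc k) \<and>
    reply \<omega> k = ((0, vzero, False), G sx (\<omega> (idx \<omega> k, Suc k)))"
    by (rule reply_cases[OF s]) (use gt in auto)
  then have r: "sq" "st + \<tau> (idx \<omega> k) \<le> tseq \<omega> (Suc k)"
    "reply \<omega> k = ((0, vzero, False), G sx (\<omega> (idx \<omega> k, Suc k)))" by auto
  have sx: "sx \<in> vecs d" by (rule state_vecs[OF s])
  have s': "state \<omega> k (idx \<omega> k) = (st, sx, True)" using s r(1) by simp
  have "prog [sx] \<le> P \<omega> k" by (rule invD(5)[OF alg_at(1) s'])
  moreover have "P \<omega> k < Suc (prog [sx])" using G_chain[OF sx] gt r(3)
    by (metis snd_conv less_le_trans)
  ultimately have px: "prog [sx] = P \<omega> k" by simp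
  have bit: "\<omega> (idx \<omega> k, Suc k) = 1"
    using G_silent[OF sx, of "\<omega> (idx \<omega> k, Suc k)"] gt r(3) px by fastforce
  have PS: "P \<omega> (Suc k) = Suc (P \<omega> k)"
    using G_chain[OF sx, of "\<omega> (idx \<omega> k, Suc k)"] gt r(3) px by (simp add: P_Suc)
  have ltd: "P \<omega> k < d" using P_le_dim[of \<omega> "Suc k"] PS by simp
  have lr: "last_reveal \<omega> (Suc k) = tseq \<omega> (Suc k)" using new by simp
  \<comment> \<open>A short phase is paid for by the hit that ends it, a long one by its
    duration.\<close>
  have "\<delta> * real (P \<omega> (Suc k)) \<le> last_reveal \<omega> (Suc k) + \<delta> * (\<Sum>j<Suc k. of_bool (hit \<omega> j))"
  proof (cases "tseq \<omega> (Suc k) < last_reveal \<omega> k + \<delta>")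
    case True
    then have "hit \<omega> k" using r s px ltd bit by (auto simp: hit_def elig_def)
    moreover have "last_reveal \<omega> k \<le> tseq \<omega> (Suc k)" using invD(1) tseq_mono[of \<omega> k] by linarith
    moreover note invD(2)
    ultimately show ?thesis unfolding lr PS by (simp add: algebra_simps)
  next
    case False
    note invD(2)
    moreover have "\<delta> * of_bool (hit \<omega> k) \<ge> 0" using delta_pos by simp
    ultimately show ?thesis using False unfolding lr PS by (simp add: algebra_simps)
  qed
  moreover have "(\<Sum>j<Suc k. of_bool (elig \<omega> j)) \<le> capacity * P \<omega> (Suc k)"
  proof (cases "elig \<omega> k")
    case False
    then show ?thesis using invD(7) sum_counters_le[of c, OF invD(3)] PS by (simp add: algebra_simps)
  next
    case True
    \<comment> \<open>The revealing step may be eligible itself and is counted first: its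
      computation started after the earlier ones counted for this oracle and ended within
      \<open>\<delta>\<close>.\<close>
    let ?c = "c(idx \<omega> k := Suc (c (idx \<omega> k)))"
    have lb: "last_reveal \<omega> k + real (c (idx \<omega> k)) * \<tau> (idx \<omega> k) \<le> st"
      by (rule invD(6)[OF alg_at(1) s' px])
    have "real (?c i) * \<tau> i < \<delta>" if "i \<in> {1..n}" for i
      using invD(3)[OF that] lb r(2) True by (cases "i = idx \<omega> k") (auto simp: elig_def algebra_simps)
    then have "(\<Sum>i=1..n. ?c i) \<le> capacity" by (rule sum_counters_le)
    moreover have "(\<Sum>i=1..n. ?c i) = Suc (\<Sum>i=1..n. c i)"
      using alg_at(1)[of \<omega> k] by (simp add: sum.remove[of _ "idx \<omega> k"])
    ultimately show ?thesis using invD(7) PS True by (simp add: algebra_simps)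
  qed
  \<comment> \<open>Pending points were submitted before the reveal, so none can produce the next
    one.\<close>
  moreover have "prog [sx'] < P \<omega> (Suc k)"
    if *: "i \<in> {1..n}" "state \<omega> (Suc k) i = (st', sx', True)" for i st' sx'
  proof -
    have "state \<omega> k i = (st', sx', True)"
      using *(2) r(3) by (cases "i = idx \<omega> k") (simp_all add: run_Suc)
    then show ?thesis using invD(5)[OF *(1)] PS by (simp add: less_Suc_eq_le)
  qed
  ultimately show ?thesis
  proof (intro invarI)
    fix i st sx
    assume "\<And>i st' sx'. i \<in> {1..n} \<Longrightarrow> state \<omega> (Suc k) i = (st', sx', True) \<Longrightarrow> prog [sx'] < P \<omega> (Suc k)"
      "i \<in> {1..n}" "state \<omega> (Suc k) i = (st, sx, True)"
    then have "prog [sx] < P \<omega> (Suc k)" by blast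
    then show "prog [sx] \<le> P \<omega> (Suc k) \<and> (prog [sx] = P \<omega> (Suc k) \<longrightarrow>
      last_reveal \<omega> (Suc k) + real 0 * \<tau> i \<le> st)" by simp
  qed (use lr delta_pos in simp_all)
qed

text \<open>Without a reveal the counters change only at an eligible step, where the counter of the
  active oracle grows by one and that oracle becomes idle. A new computation is stamped with the
  current time, which lies beyond all counted work.\<close>

lemma invar_Suc_same:
  assumes inv: "invar \<omega> k c" and same: "P \<omega> (Suc k) = P \<omega> k"
  shows "\<exists>c. invar \<omega> (Suc k) c"
proof -
  let ?i = "idx \<omega> k"
  obtain st sx sq where s: "state \<omega> k ?i = (st, sx, sq)" by (metis prod_cases3)
  note invD = invarD[OF inv]
  have lr: "last_reveal \<omega> (Suc k) = last_reveal \<omega> k" using same by simp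
  have i: "?i \<in> {1..n}" by (rule alg_at)
  have hits: "\<delta> * (\<Sum>j<k. of_bool (hit \<omega> j)) \<le> \<delta> * (\<Sum>j<Suc k. of_bool (hit \<omega> j))"
    using delta_pos by (intro mult_left_mono) auto
  have old: "prog [sx'] \<le> P \<omega> k \<and> (prog [sx'] = P \<omega> k \<longrightarrow> last_reveal \<omega> k + real (c i) * \<tau> i \<le> st')"
    if "i \<in> {1..n}" "state \<omega> k i = (st', sx', True)" for i st' sx'
    using invD(5,6) that by blast
  show ?thesis
  proof (cases "elig \<omega> k")
    case False
    have f4: "prog [sx'] \<le> P \<omega> k \<and> (prog [sx'] = P \<omega> k \<longrightarrow> last_reveal \<omega> k + real (c i) * \<tau> i \<le> st')"
      if *: "i \<in> {1..n}" "state \<omega> (Suc k) i = (st', sx', True)" for i st' sx'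
    proof (cases "i = ?i")
      case True
      have c: "last_reveal \<omega> k + real (c i) * \<tau> i \<le> tseq \<omega> (Suc k)"
        using invD(4)[OF *(1)] tseq_mono[of \<omega> k] by linarith
      show ?thesis
        by (rule reply_cases[OF s])
          (use * True prog_point_le[of \<omega> k] c old[OF *(1), of st' sx'] s in \<open>auto simp: run_Suc\<close>)
    qed (use * old[OF *(1), of st' sx'] in \<open>simp add: run_Suc\<close>)
    have f3: "real (c i) * \<tau> i < \<delta> \<and> last_reveal \<omega> k + real (c i) * \<tau> i \<le> tseq \<omega> (Suc k)"
      if "i \<in> {1..n}" for i using invD(3,4)[OF that] tseq_mono[of \<omega> k] by linarith
    have f1: "last_reveal \<omega> k \<le> tseq \<omega> (Suc k)" using invD(1) tseq_mono[of \<omega> k] by linarith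
    have f2: "\<delta> * real (P \<omega> k) \<le> last_reveal \<omega> k + \<delta> * (\<Sum>j<Suc k. of_bool (hit \<omega> j))"
      using invD(2) hits by linarith
    have f5: "(\<Sum>j<Suc k. of_bool (elig \<omega> j)) \<le> capacity * P \<omega> k + (\<Sum>i=1..n. c i)"
      using invD(7) False by simp
    have "invar \<omega> (Suc k) c"
      by (rule invarI) (unfold lr same, rule f1 f2 f3 f4 f5 invD(8); assumption)+
    then show ?thesis by blast
  next
    case True
    let ?c = "c(?i := Suc (c ?i))"
    from True s have e: "sq" "st + \<tau> ?i \<le> tseq \<omega> (Suc k)" "prog [sx] = P \<omega> k" "P \<omega> k < d"
      "tseq \<omega> (Suc k) < last_reveal \<omega> k + \<delta>" by (auto simp: elig_def)
    have lb: "last_reveal \<omega> k + real (c ?i) * \<tau> ?i \<le> st" using old[OF i, of st sx] s e by simp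
    have "reply \<omega> k = ((0, vzero, False), G sx (\<omega> (?i, Suc k)))"
      by (rule reply_cases[OF s]) (use e in auto)
    then have f4: "prog [sx'] \<le> P \<omega> k \<and> (prog [sx'] = P \<omega> k \<longrightarrow> last_reveal \<omega> k + real (?c i) * \<tau> i \<le> st')"
      if *: "i \<in> {1..n}" "state \<omega> (Suc k) i = (st', sx', True)" for i st' sx'
      using * old[OF *(1), of st' sx'] by (cases "i = ?i") (auto simp: run_Suc)
    have f3: "real (?c i) * \<tau> i < \<delta> \<and> last_reveal \<omega> k + real (?c i) * \<tau> i \<le> tseq \<omega> (Suc k)"
      if "i \<in> {1..n}" for i
    proof (cases "i = ?i")
      case True
      then show ?thesis using lb e by (simp add: algebra_simps)
    next
      case False
      then show ?thesis using invD(3,4)[OF that] tseq_mono[of \<omega> k] by auto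
    qed
    have f1: "last_reveal \<omega> k \<le> tseq \<omega> (Suc k)" using invD(1) tseq_mono[of \<omega> k] by linarith
    have sc: "(\<Sum>i=1..n. ?c i) = Suc (\<Sum>i=1..n. c i)"
      using i by (simp add: sum.remove[of _ ?i])
    have f2: "\<delta> * real (P \<omega> k) \<le> last_reveal \<omega> k + \<delta> * (\<Sum>j<Suc k. of_bool (hit \<omega> j))"
      using invD(2) hits by linarith
    have f5: "(\<Sum>j<Suc k. of_bool (elig \<omega> j)) \<le> capacity * P \<omega> k + (\<Sum>i=1..n. ?c i)"
      unfolding sc using invD(7) True by simp
    have f6: "P \<omega> k = d \<Longrightarrow> ?c i = 0" for i using e(4) by simp
    have "invar \<omega> (Suc k) ?c"
      by (rule invarI) (unfold lr same, rule f1 f2 f3 f4 f5 f6; assumption)+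
    then show ?thesis by blast
  qed
qed

lemma invar_exists: "\<exists>c. invar \<omega> k c"
proof (induction k)
  case 0
  have "invar \<omega> 0 (\<lambda>_. 0)" using delta_pos by (simp add: invar_def)
  then show ?case by blast
next
  case (Suc k)
  then show ?case using invar_Suc_new invar_Suc_same by blast
qed

text \<open>Every completed phase either lasted at least \<open>\<delta>\<close> or ended with a
  hit.\<close>

lemma progress_le_time: "\<delta> * real (P \<omega> k) \<le> tseq \<omega> k + \<delta> * (\<Sum>j<k. of_bool (hit \<omega> j))"
proof -
  obtain c where "invar \<omega> k c" using invar_exists by blast
  from invarD(1,2)[OF this] show ?thesis by linarith
qed

text \<open>Finished phases and the running one account for at most \<open>capacity\<close> eligible
  steps each. While \<open>P \<omega> k < d\<close> these are at most \<open>d\<close> phases; at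
  \<open>P \<omega> k = d\<close> the counters are 0 and the running phase adds nothing.\<close>

lemma sum_elig_le: "(\<Sum>j<k. of_bool (elig \<omega> j)) \<le> capacity * d"
proof -
  obtain c where c: "invar \<omega> k c" using invar_exists by blast
  note invD = invarD[OF c]
  show ?thesis
  proof (cases "P \<omega> k = d")
    case True
    then show ?thesis using invD(7,8) by auto
  next
    case False
    then have "Suc (P \<omega> k) \<le> d" using P_le_dim[of \<omega> k] by simp
    then have "capacity * Suc (P \<omega> k) \<le> capacity * d" by (rule mult_le_mono2)
    moreover have "(\<Sum>i=1..n. c i) \<le> capacity" by (intro sum_counters_le invD)
    moreover have "(\<Sum>j<k. of_bool (elig \<omega> j)) \<le> capacity * P \<omega> k + (\<Sum>i=1..n. c i)" by (rule invD)
    ultimately show ?thesis by simp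
  qed
qed

end

section \<open>Bernoulli noise and an unbiased oracle that hides the next coordinate\<close>

section \<open>Bernoulli noise\<close>

text \<open>The Bernoulli law is moved to the Borel reals because \<open>oracle_ok\<close> asks for
  measures there.\<close>

definition bit_measure :: "real \<Rightarrow> real measure" where
  "bit_measure p = distr (measure_pmf (bernoulli_pmf p)) borel of_bool"

lemma sets_bit_measure [simp, measurable_cong]: "sets (bit_measure p) = sets borel"
  by (simp add: bit_measure_def)

lemma space_bit_measure [simp]: "space (bit_measure p) = UNIV"
  by (simp add: bit_measure_def)

lemma prob_space_bit_measure: "prob_space (bit_measure p)"
  unfolding bit_measure_def by (intro measure_pmf.prob_space_distr) simp

lemma nn_integral_bit_measure:
  assumes "0 \<le> p" "p \<le> 1" "f \<in> borel_measurable borel"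
  shows "(\<integral>\<^sup>+x. f x \<partial>bit_measure p) = f 1 * ennreal p + f 0 * ennreal (1 - p)"
  using assms by (simp add: bit_measure_def nn_integral_distr)

lemma emeasure_bit_measure_1:
  assumes "0 \<le> p" "p \<le> 1"
  shows "emeasure (bit_measure p) {1} = ennreal p"
  using nn_integral_bit_measure[OF assms, of "indicator {1}"] by simp

lemma integral_bit_measure:
  fixes f :: "real \<Rightarrow> real"
  assumes "0 \<le> p" "p \<le> 1" "f \<in> borel_measurable borel"
  shows "integrable (bit_measure p) f" "(\<integral>x. f x \<partial>bit_measure p) = p * f 1 + (1 - p) * f 0"
proof -
  have "integrable (measure_pmf (bernoulli_pmf p)) (\<lambda>b. f (of_bool b))"
    by (rule integrable_measure_pmf_finite) simp
  then show "integrable (bit_measure p) f"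
    using assms by (simp add: bit_measure_def integrable_distr_eq)
  show "(\<integral>x. f x \<partial>bit_measure p) = p * f 1 + (1 - p) * f 0"
    using assms by (simp add: bit_measure_def integral_distr)
qed

text \<open>Only coordinate \<open>prog [x]\<close>, the first one not yet in reach of
  \<open>x\<close>, is randomised; division by \<open>p\<close> keeps the mean.\<close>

definition bit_oracle :: "nat \<Rightarrow> real \<Rightarrow> real \<Rightarrow> real \<Rightarrow> vec \<Rightarrow> real \<Rightarrow> vec" where
  "bit_oracle d \<mu> c p x \<xi> j =
     c * weights d \<mu> x j * (if j = prog [x] then of_bool (\<xi> = 1) / p else 1)"

lemma bit_oracle_vecs [simp]: "bit_oracle d \<mu> c p x \<xi> \<in> vecs d"
  using weights_in_vecs[of d \<mu> x] by (auto simp: vecs_def bit_oracle_def)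

lemma bit_oracle_cong: "(\<xi> = 1) = (\<xi>' = 1) \<Longrightarrow> bit_oracle d \<mu> c p x \<xi> = bit_oracle d \<mu> c p x \<xi>'"
  by (simp add: bit_oracle_def fun_eq_iff)

text \<open>By \<open>weights_zero_chain\<close> the gradient vanishes beyond
  \<open>prog [x]\<close>, and an unset bit removes that coordinate too.\<close>

lemma prog_bit_oracle:
  assumes "d \<ge> 1" "\<mu> > 0" "x \<in> vecs d"
  shows "prog [bit_oracle d \<mu> c p x \<xi>] \<le> Suc (prog [x])"
    and "\<xi> \<noteq> 1 \<Longrightarrow> prog [bit_oracle d \<mu> c p x \<xi>] \<le> prog [x]"
proof -
  have w: "weights d \<mu> x i = 0" if "i > prog [x]" for i
    using weights_zero_chain[OF assms(1,2) _ that] zero_above_prog[OF assms(3)] by blast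
  show "prog [bit_oracle d \<mu> c p x \<xi>] \<le> Suc (prog [x])"
    using w by (subst prog_single_le_iff[of _ d]) (auto simp: bit_oracle_def)
  show "prog [bit_oracle d \<mu> c p x \<xi>] \<le> prog [x]" if "\<xi> \<noteq> 1"
    using w that by (subst prog_single_le_iff[of _ d]) (auto simp: bit_oracle_def)
qed

lemma bit_oracle_error_le:
  assumes "d \<ge> 1" "\<mu> > 0"
  shows "(vnorm d (\<lambda>j. bit_oracle d \<mu> c p x \<xi> j - c * weights d \<mu> x j))\<^sup>2
    \<le> c\<^sup>2 * (of_bool (\<xi> = 1) / p - 1)\<^sup>2"
proof -
  let ?b = "of_bool (\<xi> = 1) / p - 1 :: real" and ?w = "weights d \<mu> x"
  have "(vnorm d (\<lambda>j. bit_oracle d \<mu> c p x \<xi> j - c * ?w j))\<^sup>2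
      = (\<Sum>j<d. if j = prog [x] then (c * ?w j * ?b)\<^sup>2 else 0)"
    unfolding vinner_self[symmetric] vinner_def
    by (intro sum.cong) (auto simp: bit_oracle_def power2_eq_square algebra_simps)
  also have "\<dots> = (if prog [x] < d then c\<^sup>2 * ?b\<^sup>2 * (?w (prog [x]))\<^sup>2 else 0)"
    by (simp add: sum.delta power_mult_distrib mult_ac)
  also have "(if prog [x] < d then c\<^sup>2 * ?b\<^sup>2 * (?w (prog [x]))\<^sup>2 else 0) \<le> c\<^sup>2 * ?b\<^sup>2"
  proof -
    have "(?w (prog [x]))\<^sup>2 \<le> 1"
      by (intro power_le_one weights_nonneg weights_le_1 assms)
    then show ?thesis
      using mult_left_mono[of "(?w (prog [x]))\<^sup>2" 1 "c\<^sup>2 * ?b\<^sup>2"] by simp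
  qed
  finally show ?thesis by simp
qed

text \<open>The factor bit over \<open>p\<close> has mean 1 and variance \<open>(1 - p) / p\<close>;
  \<open>var\<close> is the resulting variance bound without denominators.\<close>

lemma oracle_ok_bit_oracle:
  assumes d: "d \<ge> 1" "\<mu> > 0" and p: "0 < p" "p \<le> 1" and var: "c\<^sup>2 * (1 - p) \<le> p * \<sigma>\<^sup>2"
  shows "oracle_ok d n R \<sigma> (\<lambda>x. c * smooth_max d \<mu> x) (\<lambda>_. bit_measure p) (bit_oracle d \<mu> c p)"
  unfolding oracle_ok_def
proof (intro conjI ballI allI)
  fix x assume "x \<in> vball d R"
  then have x: "x \<in> vecs d" by (simp add: vball_def)
  note g = vgrad_smooth_max[OF d x]
  have meas: "(\<lambda>\<xi>. bit_oracle d \<mu> c p x \<xi> j) \<in> borel_measurable borel" for j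
    unfolding bit_oracle_def by measurable
  fix j
  show "integrable (bit_measure p) (\<lambda>\<xi>. bit_oracle d \<mu> c p x \<xi> j)"
    using p by (intro integral_bit_measure meas) auto
  have "(\<integral>\<xi>. bit_oracle d \<mu> c p x \<xi> j \<partial>bit_measure p)
      = p * bit_oracle d \<mu> c p x 1 j + (1 - p) * bit_oracle d \<mu> c p x 0 j"
    using p by (intro integral_bit_measure meas) auto
  also have "\<dots> = c * weights d \<mu> x j"
    using p by (cases "j = prog [x]") (simp_all add: bit_oracle_def algebra_simps)
  finally show "(\<integral>\<xi>. bit_oracle d \<mu> c p x \<xi> j \<partial>bit_measure p)
      = vgrad d (\<lambda>x. c * smooth_max d \<mu> x) x j"
    by (simp add: g)
next
  fix x assume "x \<in> vball d R"
  then have x: "x \<in> vecs d" by (simp add: vball_def)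
  let ?f = "\<lambda>\<xi>::real. ennreal (c\<^sup>2 * (of_bool (\<xi> = 1) / p - 1)\<^sup>2)"
  have "?f 1 * ennreal p + ?f 0 * ennreal (1 - p)
      = ennreal (c\<^sup>2 * (1 / p - 1)\<^sup>2 * p + c\<^sup>2 * (1 - p))"
    using p by (simp add: ennreal_mult[symmetric] ennreal_plus[symmetric] del: ennreal_plus)
  also have "c\<^sup>2 * (1 / p - 1)\<^sup>2 * p + c\<^sup>2 * (1 - p) = c\<^sup>2 * (1 - p) / p"
    using p by (simp add: field_simps power2_eq_square)
  also have "\<dots> \<le> \<sigma>\<^sup>2" using p var by (simp add: field_simps)
  finally have le: "?f 1 * ennreal p + ?f 0 * ennreal (1 - p) \<le> ennreal (\<sigma>\<^sup>2)"
    by (simp add: ennreal_leI)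
  have "(\<integral>\<^sup>+\<xi>. ennreal ((vnorm d (\<lambda>j. bit_oracle d \<mu> c p x \<xi> j
          - vgrad d (\<lambda>x. c * smooth_max d \<mu> x) x j))\<^sup>2) \<partial>bit_measure p) \<le> (\<integral>\<^sup>+\<xi>. ?f \<xi> \<partial>bit_measure p)"
    unfolding vgrad_smooth_max[OF d x]
    by (intro nn_integral_mono ennreal_leI bit_oracle_error_le d)
  also have "\<dots> = ?f 1 * ennreal p + ?f 0 * ennreal (1 - p)"
    using p by (intro nn_integral_bit_measure) auto
  also note le
  finally show "(\<integral>\<^sup>+\<xi>. ennreal ((vnorm d (\<lambda>j. bit_oracle d \<mu> c p x \<xi> j
      - vgrad d (\<lambda>x. c * smooth_max d \<mu> x) x j))\<^sup>2) \<partial>bit_measure p) \<le> ennreal (\<sigma>\<^sup>2)" .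
qed (simp_all add: prob_space_bit_measure)

section \<open>Independence of the next bit and the expected number of hits\<close>

section \<open>Counting hits\<close>

text \<open>The algorithm is an arbitrary function, but the first \<open>k\<close> steps of a run depend on the samples
  only through finitely many bits, so all events below are finite unions of cylinders.\<close>

definition trunc :: "nat \<Rightarrow> nat \<Rightarrow> (nat \<times> nat \<Rightarrow> real) \<Rightarrow> nat \<times> nat \<Rightarrow> real" where
  "trunc n k \<omega> = (\<lambda>x. of_bool (x \<in> {1..n} \<times> {1..k} \<and> \<omega> x = 1))"

lemma xi_space_const: "xi_space n (\<lambda>_. B) = PiM ({1..n} \<times> UNIV) (\<lambda>_. B)"
  by (simp add: xi_space_def case_prod_unfold)

text \<open>The event splits into finitely many cylinders, one per bit pattern \<open>v\<close>. On
  each of them the random index \<open>ix \<omega>\<close> is the constant \<open>ix v\<close>, so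
  the next bit is one more independent coordinate and contributes the factor
  \<open>p\<close>.\<close>

lemma
  fixes Q :: "(nat \<times> nat \<Rightarrow> real) \<Rightarrow> bool" and ix :: "(nat \<times> nat \<Rightarrow> real) \<Rightarrow> nat"
  assumes p: "0 \<le> p" "p \<le> 1"
    and Q: "\<And>\<omega>. Q (trunc n k \<omega>) = Q \<omega>"
  defines "M \<equiv> xi_space n (\<lambda>_. bit_measure p)"
  shows measurable_trunc_event: "{\<omega> \<in> space M. Q \<omega>} \<in> sets M"
    and emeasure_next_bit: "(\<And>\<omega>. ix (trunc n k \<omega>) = ix \<omega>) \<Longrightarrow> (\<And>\<omega>. ix \<omega> \<in> {1..n}) \<Longrightarrow>
      {\<omega> \<in> space M. Q \<omega> \<and> \<omega> (ix \<omega>, Suc k) = 1} \<in> sets M \<and>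
      emeasure M {\<omega> \<in> space M. Q \<omega> \<and> \<omega> (ix \<omega>, Suc k) = 1} = ennreal p * emeasure M {\<omega> \<in> space M. Q \<omega>}"
proof -
  let ?I = "{1..n} \<times> {1..k}" and ?B = "bit_measure p"
  interpret product_prob_space "\<lambda>_::nat \<times> nat. ?B" "{1..n} \<times> (UNIV::nat set)"
    by (intro product_prob_spaceI prob_space_bit_measure)
  have M: "M = PiM ({1..n} \<times> UNIV) (\<lambda>_. ?B)" unfolding M_def by (rule xi_space_const)
  define V :: "(nat \<times> nat \<Rightarrow> real) set" where "V = (\<lambda>S x. of_bool (x \<in> S)) ` Pow ?I"
  have V: "finite V" unfolding V_def by (intro finite_imageI) simp
  have trunc_V: "trunc n k \<omega> \<in> V" for \<omega>
    unfolding V_def trunc_def by (rule image_eqI[of _ _ "{x \<in> ?I. \<omega> x = 1}"]) auto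
  \<comment> \<open>An unset bit means any value other than 1, since samples range over all
    reals.\<close>
  define X where "X = (\<lambda>(v :: nat \<times> nat \<Rightarrow> real) x. if v x = 1 then {1} else - {1::real})"
  have X: "X v x \<in> sets borel" for v :: "nat \<times> nat \<Rightarrow> real" and x by (auto simp: X_def)
  have cyl: "{\<omega> \<in> space M. trunc n k \<omega> = v} = {\<omega> \<in> space M. \<forall>x\<in>?I. \<omega> x \<in> X v x}" if "v \<in> V" for v
  proof -
    from that obtain S where S: "S \<subseteq> ?I" "v = (\<lambda>x. of_bool (x \<in> S))" by (auto simp: V_def)
    have "trunc n k \<omega> = v \<longleftrightarrow> (\<forall>x\<in>?I. \<omega> x \<in> X v x)" for \<omega>
    proof -
      have "trunc n k \<omega> = v \<longleftrightarrow> (\<forall>x. (x \<in> ?I \<and> \<omega> x = 1) = (x \<in> S))"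
        by (simp only: S(2) trunc_def fun_eq_iff of_bool_eq_iff)
      also have "\<dots> \<longleftrightarrow> (\<forall>x\<in>?I. (\<omega> x = 1) = (x \<in> S))" using S(1) by blast
      also have "\<dots> \<longleftrightarrow> (\<forall>x\<in>?I. \<omega> x \<in> X v x)" by (intro ball_cong) (auto simp: X_def S(2))
      finally show ?thesis .
    qed
    then show ?thesis by auto
  qed
  have meas: "{\<omega> \<in> space M. \<forall>x\<in>J. \<omega> x \<in> Y x} \<in> sets M"
    if "finite J" "J \<subseteq> {1..n} \<times> UNIV" "\<And>x. Y x \<in> sets ?B" for J Y
  proof -
    \<comment> \<open>The empty intersection would be \<open>UNIV\<close> instead of
      \<open>space M\<close>.\<close>
    have "{\<omega> \<in> space M. \<forall>x\<in>J. \<omega> x \<in> Y x} = (if J = {} then space M else (\<Inter>x\<in>J. {\<omega> \<in> space M. \<omega> x \<in> Y x}))"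
      by auto
    moreover have "{\<omega> \<in> space M. \<omega> x \<in> Y x} \<in> sets M" if "x \<in> J" for x
    proof -
      have "Y x \<in> sets ?B" by fact
      have "(\<lambda>\<omega>. \<omega> x) \<in> measurable M ?B"
        unfolding M using that \<open>J \<subseteq> _\<close> by (intro measurable_component_singleton) auto
      from measurable_sets[OF this \<open>Y x \<in> sets ?B\<close>] show ?thesis
        by (simp add: vimage_def Int_def conj_commute)
    qed
    ultimately show ?thesis using \<open>finite J\<close> by (auto intro!: sets.finite_INT)
  qed
  have union: "{\<omega> \<in> space M. Q \<omega>} = (\<Union>v\<in>{v \<in> V. Q v}. {\<omega> \<in> space M. trunc n k \<omega> = v})"
    using trunc_V Q by auto
  have cyl_sets: "{\<omega> \<in> space M. trunc n k \<omega> = v} \<in> sets M" if "v \<in> V" for v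
    unfolding cyl[OF that] by (intro meas) (auto simp: X)
  show Qs: "{\<omega> \<in> space M. Q \<omega>} \<in> sets M"
    unfolding union using V cyl_sets by (intro sets.finite_UN) auto
  assume ix: "\<And>\<omega>. ix (trunc n k \<omega>) = ix \<omega>" "\<And>\<omega>. ix \<omega> \<in> {1..n}"
  let ?C = "\<lambda>v. {\<omega> \<in> space M. trunc n k \<omega> = v \<and> \<omega> (ix v, Suc k) = 1}"
  let ?J = "\<lambda>v. insert (ix v, Suc k) ?I"
  let ?Y = "\<lambda>v x. if x = (ix v, Suc k) then {1} else X v x"
  have union': "{\<omega> \<in> space M. Q \<omega> \<and> \<omega> (ix \<omega>, Suc k) = 1} = (\<Union>v\<in>{v \<in> V. Q v}. ?C v)"
    using trunc_V Q ix(1) by auto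
  have C: "?C v = {\<omega> \<in> space M. \<forall>x\<in>?J v. \<omega> x \<in> ?Y v x}" if "v \<in> V" for v
  proof -
    have "?C v = {\<omega> \<in> space M. trunc n k \<omega> = v} \<inter> {\<omega>. \<omega> (ix v, Suc k) = 1}" by auto
    then show ?thesis unfolding cyl[OF that] by auto
  qed
  have C_sets: "?C v \<in> sets M" if "v \<in> V" for v
    unfolding C[OF that] using ix(2)[of v] by (intro meas) (auto simp: X)
  have C_em: "emeasure M (?C v) = ennreal p * emeasure M {\<omega> \<in> space M. trunc n k \<omega> = v}"
    if "v \<in> V" for v
  proof -
    have "emeasure M (?C v) = (\<Prod>x\<in>?J v. emeasure ?B (?Y v x))"
      unfolding C[OF that] unfolding M using ix(2)[of v] by (intro emeasure_PiM_Collect) (auto simp: X)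
    \<comment> \<open>The new index is outside \<open>?I\<close>, whose second components stop at
      \<open>k\<close>.\<close>
    also have "\<dots> = emeasure ?B {1} * (\<Prod>x\<in>?I. emeasure ?B (X v x))"
      by (subst prod.insert) (auto intro!: arg_cong2[where f = "(*)"] prod.cong)
    also have "(\<Prod>x\<in>?I. emeasure ?B (X v x)) = emeasure M {\<omega> \<in> space M. trunc n k \<omega> = v}"
      unfolding cyl[OF that] unfolding M by (intro emeasure_PiM_Collect[symmetric]) (auto simp: X)
    finally show ?thesis using p by (simp add: emeasure_bit_measure_1)
  qed
  have "emeasure M {\<omega> \<in> space M. Q \<omega> \<and> \<omega> (ix \<omega>, Suc k) = 1} = (\<Sum>v\<in>{v \<in> V. Q v}. emeasure M (?C v))"
    unfolding union' using V C_sets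
    by (intro sum_emeasure[symmetric]) (auto simp: disjoint_family_on_def)
  also have "\<dots> = ennreal p * (\<Sum>v\<in>{v \<in> V. Q v}. emeasure M {\<omega> \<in> space M. trunc n k \<omega> = v})"
    by (simp add: sum_distrib_left C_em)
  also have "(\<Sum>v\<in>{v \<in> V. Q v}. emeasure M {\<omega> \<in> space M. trunc n k \<omega> = v}) = emeasure M {\<omega> \<in> space M. Q \<omega>}"
    unfolding union using V cyl_sets
    by (intro sum_emeasure) (auto simp: disjoint_family_on_def)
  finally show "{\<omega> \<in> space M. Q \<omega> \<and> \<omega> (ix \<omega>, Suc k) = 1} \<in> sets M \<and>
      emeasure M {\<omega> \<in> space M. Q \<omega> \<and> \<omega> (ix \<omega>, Suc k) = 1} = ennreal p * emeasure M {\<omega> \<in> space M. Q \<omega>}"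
    unfolding union' using V C_sets by (auto intro!: sets.finite_UN)
qed

context chain_run
begin

text \<open>Step \<open>j\<close> reads sample \<open>Suc j \<le> k\<close> of an oracle in
  \<open>{1..n}\<close>; truncation keeps its bit, and \<open>G\<close> sees nothing else.\<close>

lemma run_trunc:
  "j \<le> k \<Longrightarrow> state (trunc n k \<omega>) j = state \<omega> j \<and> gr (trunc n k \<omega>) j = gr \<omega> j"
proof (induction j)
  case (Suc j)
  then have IH: "state (trunc n k \<omega>) j = state \<omega> j" "gr (trunc n k \<omega>) j = gr \<omega> j" by auto
  have i: "idx (trunc n k \<omega>) j = idx \<omega> j" by (simp add: idx_def IH)
  have "(trunc n k \<omega> (idx \<omega> j, Suc j) = 1) = (\<omega> (idx \<omega> j, Suc j) = 1)"
    using alg_at(1)[of \<omega> j] Suc.prems by (simp add: trunc_def)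
  then have "G x (trunc n k \<omega> (idx \<omega> j, Suc j)) = G x (\<omega> (idx \<omega> j, Suc j))" for x
    by (rule G_bit)
  then have "reply (trunc n k \<omega>) j = reply \<omega> j"
    by (simp add: reply_def i IH time_seq_def point_seq_def delayed_oracle_def split: prod.splits)
  then show ?case by (simp add: run_Suc IH i)
qed simp

lemma last_reveal_trunc: "j \<le> k \<Longrightarrow> last_reveal (trunc n k \<omega>) j = last_reveal \<omega> j"
proof (induction j)
  case (Suc j)
  then have "gr (trunc n k \<omega>) j = gr \<omega> j" "gr (trunc n k \<omega>) (Suc j) = gr \<omega> (Suc j)"
    using run_trunc by auto
  then show ?case using Suc by (simp add: P_def time_seq_def)
qed simp

lemma idx_trunc: "idx (trunc n k \<omega>) k = idx \<omega> k"
  using run_trunc by (simp add: idx_def)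

text \<open>Eligibility at step \<open>k\<close>, including the time
  \<open>tseq \<omega> (Suc k)\<close>, is settled by the first \<open>k\<close> replies, before
  sample \<open>Suc k\<close> is read.\<close>

lemma elig_trunc: "elig (trunc n k \<omega>) k = elig \<omega> k"
  using run_trunc[of k k \<omega>] last_reveal_trunc[of k k \<omega>] idx_trunc[of k \<omega>]
  by (simp add: elig_def P_def time_seq_def)

text \<open>Hits occur with probability \<open>p\<close> at each eligible step, and there are at most
  \<open>d * capacity\<close> eligible steps on every path, so Markov's inequality bounds the number of hits.\<close>

lemma good_event:
  assumes p: "0 \<le> p" "p \<le> 1" "p * real capacity \<le> 1 / 4" and d: "d \<ge> 1"
  defines "M \<equiv> xi_space n (\<lambda>_. bit_measure p)"
  shows "\<exists>E\<in>sets M. emeasure M E \<ge> ennreal (1 / 2) \<and>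
    (\<forall>\<omega>\<in>E. \<forall>k. tseq \<omega> k \<le> \<delta> * real d / 2 \<longrightarrow> P \<omega> k < d)"
proof -
  interpret prob_space M
    unfolding M_def xi_space_const by (intro prob_space_PiM prob_space_bit_measure)
  have E_sets: "{\<omega> \<in> space M. elig \<omega> k} \<in> sets M" for k
    unfolding M_def using p elig_trunc by (intro measurable_trunc_event)
  have H: "{\<omega> \<in> space M. hit \<omega> k} \<in> sets M \<and>
      emeasure M {\<omega> \<in> space M. hit \<omega> k} = ennreal p * emeasure M {\<omega> \<in> space M. elig \<omega> k}" for k
    unfolding M_def hit_def
    using p elig_trunc idx_trunc alg_at(1)
    by (intro emeasure_next_bit[where Q = "\<lambda>\<omega>. elig \<omega> k" and ix = "\<lambda>\<omega>. idx \<omega> k"])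
  let ?h = "\<lambda>k \<omega>. indicator {\<omega> \<in> space M. hit \<omega> k} \<omega> :: ennreal"
  let ?e = "\<lambda>k \<omega>. indicator {\<omega> \<in> space M. elig \<omega> k} \<omega> :: ennreal"
  \<comment> \<open>A series over all steps, as an algorithm may make arbitrarily many queries
    before a given time.\<close>
  define X where "X = (\<lambda>\<omega>. \<Sum>k. ?h k \<omega>)"
  have X_meas [measurable]: "X \<in> borel_measurable M"
    unfolding X_def using H by (intro borel_measurable_suminf_order borel_measurable_indicator) auto
  have "(\<integral>\<^sup>+\<omega>. X \<omega> \<partial>M) = (\<Sum>k. \<integral>\<^sup>+\<omega>. ?h k \<omega> \<partial>M)"
    unfolding X_def using H by (intro nn_integral_suminf borel_measurable_indicator) auto
  also have "\<dots> = (\<Sum>k. ennreal p * (\<integral>\<^sup>+\<omega>. ?e k \<omega> \<partial>M))"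
    using H E_sets by (simp add: nn_integral_indicator)
  also have "\<dots> = ennreal p * (\<integral>\<^sup>+\<omega>. (\<Sum>k. ?e k \<omega>) \<partial>M)"
    using E_sets by (simp add: ennreal_suminf_cmult nn_integral_suminf)
  also have "(\<integral>\<^sup>+\<omega>. (\<Sum>k. ?e k \<omega>) \<partial>M) \<le> (\<integral>\<^sup>+\<omega>. ennreal (real (capacity * d)) \<partial>M)"
  proof (intro nn_integral_mono suminf_le_const summableI)
    fix \<omega> m assume "\<omega> \<in> space M"
    then have "(\<Sum>k<m. ?e k \<omega>) = of_nat (\<Sum>k<m. of_bool (elig \<omega> k))"
      by (simp add: indicator_def)
    also have "\<dots> \<le> of_nat (capacity * d)" by (intro of_nat_mono sum_elig_le)
    finally show "(\<Sum>k<m. ?e k \<omega>) \<le> ennreal (real (capacity * d))" by (simp add: ennreal_of_nat_eq_real_of_nat)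
  qed
  also have "\<dots> = ennreal (real (capacity * d))" by (simp add: emeasure_space_1)
  finally have "(\<integral>\<^sup>+\<omega>. X \<omega> \<partial>M) \<le> ennreal p * ennreal (real (capacity * d))"
    by (simp add: mult_left_mono)
  also have "\<dots> = ennreal (p * real (capacity * d))" using p by (simp add: ennreal_mult)
  also have "\<dots> \<le> ennreal (real d / 4)"
    using mult_right_mono[OF p(3), of "real d"] by (intro ennreal_leI) (simp add: mult_ac)
  finally have EX: "(\<integral>\<^sup>+\<omega>. X \<omega> \<partial>M) \<le> ennreal (real d / 4)" .
  \<comment> \<open>At least \<open>d / 2\<close> hits, in the form of Markov's inequality; the mean
    \<open>d / 4\<close> gives probability at most 1/2.\<close>
  define bad where "bad = {\<omega> \<in> space M. 1 \<le> ennreal (2 / real d) * X \<omega>}"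
  have bad_sets [measurable]: "bad \<in> sets M" unfolding bad_def by measurable
  have "emeasure M bad \<le> ennreal (2 / real d) * (\<integral>\<^sup>+\<omega>. X \<omega> * indicator (space M) \<omega> \<partial>M)"
    unfolding bad_def by (rule nn_integral_Markov_inequality) auto
  also have "(\<integral>\<^sup>+\<omega>. X \<omega> * indicator (space M) \<omega> \<partial>M) = (\<integral>\<^sup>+\<omega>. X \<omega> \<partial>M)"
    by (intro nn_integral_cong) simp
  also have "ennreal (2 / real d) * (\<integral>\<^sup>+\<omega>. X \<omega> \<partial>M) \<le> ennreal (2 / real d) * ennreal (real d / 4)"
    by (intro mult_left_mono EX) simp
  also have "\<dots> = ennreal (1 / 2)" using d by (simp add: ennreal_mult[symmetric])
  finally have "prob bad \<le> 1 / 2"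
    unfolding emeasure_eq_measure by (subst (asm) ennreal_le_iff) auto
  then have "prob (space M - bad) \<ge> 1 / 2" by (simp add: prob_compl)
  then have pr: "emeasure M (space M - bad) \<ge> ennreal (1 / 2)"
    unfolding emeasure_eq_measure by (rule ennreal_leI)
  have "P \<omega> k < d" if w: "\<omega> \<in> space M - bad" and t: "tseq \<omega> k \<le> \<delta> * real d / 2" for \<omega> k
  proof (rule ccontr)
    assume "\<not> P \<omega> k < d"
    then have "P \<omega> k = d" using P_le_dim[of \<omega> k] by simp
    then have "\<delta> * real d \<le> \<delta> * real d / 2 + \<delta> * (\<Sum>j<k. of_bool (hit \<omega> j))"
      using progress_le_time[of \<omega> k] t by simp
    then have "\<delta> * (real d / 2) \<le> \<delta> * (\<Sum>j<k. of_bool (hit \<omega> j))" by simp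
    then have "real d / 2 \<le> (\<Sum>j<k. of_bool (hit \<omega> j))" using delta_pos by simp
    then have "ennreal (real d / 2) \<le> ennreal (\<Sum>j<k. of_bool (hit \<omega> j))" by (rule ennreal_leI)
    also have "\<dots> = (\<Sum>j<k. ?h j \<omega>)"
      using w by (subst sum_ennreal[symmetric])
        (auto intro!: sum.cong simp: indicator_def ennreal_of_nat_eq_real_of_nat)
    also have "\<dots> \<le> X \<omega>" unfolding X_def by (intro sum_le_suminf summableI) auto
    finally have "ennreal (2 / real d) * ennreal (real d / 2) \<le> ennreal (2 / real d) * X \<omega>"
      by (rule mult_left_mono) simp
    then have "1 \<le> ennreal (2 / real d) * X \<omega>" using d by (simp add: ennreal_mult[symmetric])
    then show False using w by (simp add: bad_def)
  qed
  with pr bad_sets show ?thesis by (intro bexI[of _ "space M - bad"]) auto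
qed

end

section \<open>Choice of parameters and the final bound\<close>

section \<open>The lower bound\<close>

text \<open>On the good event coordinate \<open>d - 1\<close> of every query made in time is zero,
  which keeps the gap at least \<open>g\<close>. The integrand thus dominates \<open>g\<close> times
  an indicator of probability at least 1/2.\<close>

lemma hard_instance_gap:
  fixes d :: nat and \<mu> c p R \<delta> t g :: real
  assumes alg: "alg_zr n d R A" and tau: "\<And>i. i \<in> {1..n} \<Longrightarrow> \<tau> i > 0"
    and d: "d \<ge> 1" and \<mu>: "\<mu> > 0" and c: "c \<ge> 0" and p: "0 < p" "p \<le> 1" and R: "R > 0"
    and \<delta>: "\<delta> > 0" and cap: "p * real (\<Sum>i=1..n. nat \<lfloor>\<delta> / \<tau> i\<rfloor>) \<le> 1 / 4"
    and t: "0 \<le> t" "t \<le> \<delta> * real d / 2"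
    and g: "0 \<le> g" "g \<le> c * (R / sqrt d) - c * (\<mu> * d)"
  defines "f \<equiv> \<lambda>x. c * smooth_max d \<mu> x" and "G \<equiv> bit_oracle d \<mu> c p"
  shows "(\<integral>\<^sup>+\<omega>. ennreal ((INF k\<in>S_set A \<tau> G \<omega> t. f (point_seq A \<tau> G \<omega> k))
      - (INF x\<in>vball d R. f x)) \<partial>xi_space n (\<lambda>_. bit_measure p)) \<ge> ennreal (g / 2)"
proof -
  interpret chain_run n d R \<delta> A \<tau> G
    unfolding G_def
    by (rule chain_run.intro)
      (fact alg, erule tau, fact \<delta>, rule bit_oracle_vecs, erule bit_oracle_cong,
        erule prog_bit_oracle(1)[OF d \<mu>], erule prog_bit_oracle(2)[OF d \<mu>])
  let ?M = "xi_space n (\<lambda>_. bit_measure p)"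
  have "p * real capacity \<le> 1 / 4" using cap by (simp add: capacity_def)
  from good_event[OF less_imp_le[OF p(1)] p(2) this d] obtain E where E: "E \<in> sets ?M"
    "emeasure ?M E \<ge> ennreal (1 / 2)"
    "\<And>\<omega> k. \<omega> \<in> E \<Longrightarrow> tseq \<omega> k \<le> \<delta> * real d / 2 \<Longrightarrow> P \<omega> k < d" by blast
  have gap: "g \<le> (INF k\<in>S_set A \<tau> G \<omega> t. f (point_seq A \<tau> G \<omega> k)) - (INF x\<in>vball d R. f x)"
    if w: "\<omega> \<in> E" for \<omega>
  proof -
    have "- (c * (\<mu> * d)) \<le> (INF k\<in>S_set A \<tau> G \<omega> t. f (point_seq A \<tau> G \<omega> k))"
    proof (rule cINF_greatest)
      \<comment> \<open>A lower bound on the infimum needs a nonempty index set; the protocol starts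
        at time 0.\<close>
      have "0 \<in> S_set A \<tau> G \<omega> t" using t(1) by (simp add: S_set_def)
      then show "S_set A \<tau> G \<omega> t \<noteq> {}" by blast
      fix k assume "k \<in> S_set A \<tau> G \<omega> t"
      then have "P \<omega> k < d" using t(2) by (intro E(3)[OF w]) (simp add: S_set_def)
      then have "prog [point_seq A \<tau> G \<omega> k] \<le> d - 1" using prog_point_le[of \<omega> k] by simp
      then have "point_seq A \<tau> G \<omega> k (d - 1) = 0"
        using alg_at(3)[of \<omega> k] by (intro zero_above_prog) (auto simp: vball_def)
      then have "- (\<mu> * d) \<le> smooth_max d \<mu> (point_seq A \<tau> G \<omega> k)"
        using smooth_max_ge_of_coord[OF d \<mu>, of "d - 1" "point_seq A \<tau> G \<omega> k"] d by simp
      then show "- (c * (\<mu> * d)) \<le> f (point_seq A \<tau> G \<omega> k)"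
        unfolding f_def using mult_left_mono[OF _ c] by fastforce
    qed
    moreover have "(INF x\<in>vball d R. f x) \<le> - (c * (R / sqrt d))"
      unfolding f_def by (rule Inf_smooth_max_le[OF d \<mu> c R])
    ultimately show ?thesis using g(2) by linarith
  qed
  have "ennreal (g / 2) = ennreal g * ennreal (1 / 2)" using g(1) by (subst ennreal_mult[symmetric]) auto
  also have "\<dots> \<le> ennreal g * emeasure ?M E" by (intro mult_left_mono E) simp
  also have "\<dots> = (\<integral>\<^sup>+\<omega>. ennreal g * indicator E \<omega> \<partial>?M)"
    using E(1) by (simp add: nn_integral_cmult_indicator)
  also have "\<dots> \<le> (\<integral>\<^sup>+\<omega>. ennreal ((INF k\<in>S_set A \<tau> G \<omega> t. f (point_seq A \<tau> G \<omega> k))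
      - (INF x\<in>vball d R. f x)) \<partial>?M)"
    using gap by (intro nn_integral_mono) (auto simp: indicator_def intro!: ennreal_leI)
  finally show ?thesis .
qed

text \<open>If \<open>m\<close> oracles are faster than \<open>\<delta>\<close>, then \<open>m \<le> \<delta> * (\<Sum>i=1..m. 1 / \<tau> i) \<le> (m + 1 / p) / 5\<close>,
  so \<open>m\<close> is at most \<open>1 / (4 * p)\<close> and the middle term as well.\<close>

lemma capacity_bound:
  fixes \<tau> :: "nat \<Rightarrow> real"
  assumes tau: "\<And>i. i \<in> {1..n} \<Longrightarrow> \<tau> i > 0"
    and mono: "\<And>i j. 1 \<le> i \<Longrightarrow> i \<le> j \<Longrightarrow> j \<le> n \<Longrightarrow> \<tau> i \<le> \<tau> j"
    and p: "0 < p" and \<delta>: "\<delta> > 0"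
    and le: "\<And>m. m \<in> {1..n} \<Longrightarrow> 5 * \<delta> * (\<Sum>i=1..m. 1 / \<tau> i) \<le> real m + 1 / p"
  shows "p * real (\<Sum>i=1..n. nat \<lfloor>\<delta> / \<tau> i\<rfloor>) \<le> 1 / 4"
proof -
  define S where "S = {i \<in> {1..n}. \<tau> i \<le> \<delta>}"
  have slow: "nat \<lfloor>\<delta> / \<tau> i\<rfloor> = 0" if "i \<in> {1..n} - S" for i
  proof -
    have "\<delta> / \<tau> i < 1" using that tau[of i] by (auto simp: S_def)
    then have "\<lfloor>\<delta> / \<tau> i\<rfloor> < 1" by linarith
    then show ?thesis by simp
  qed
  have sum_S: "(\<Sum>i=1..n. nat \<lfloor>\<delta> / \<tau> i\<rfloor>) = (\<Sum>i\<in>S. nat \<lfloor>\<delta> / \<tau> i\<rfloor>)"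
    by (rule sum.mono_neutral_right) (use slow in \<open>auto simp: S_def\<close>)
  show ?thesis
  proof (cases "S = {}")
    case True
    then show ?thesis unfolding sum_S by simp
  next
    case False
    define m where "m = Max S"
    have fin: "finite S" by (simp add: S_def)
    have m: "m \<in> S" unfolding m_def by (rule Max_in[OF fin False])
    \<comment> \<open>As the delays are sorted, the fast oracles form an initial segment, to which
      \<open>le\<close> applies.\<close>
    have S: "S = {1..m}"
    proof
      show "S \<subseteq> {1..m}" using Max_ge[OF fin] by (auto simp: m_def S_def)
      show "{1..m} \<subseteq> S" using m mono[of _ m] by (fastforce simp: S_def)
    qed
    have mn: "m \<in> {1..n}" using m by (simp add: S_def)
    let ?s = "\<delta> * (\<Sum>i=1..m. 1 / \<tau> i)"
    have s: "?s = (\<Sum>i=1..m. \<delta> / \<tau> i)" by (simp add: sum_distrib_left)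
    have "(\<Sum>i=1..m. 1) \<le> (\<Sum>i=1..m. \<delta> / \<tau> i)"
    proof (rule sum_mono)
      fix i assume "i \<in> {1..m}"
      then have "i \<in> S" by (simp add: S)
      then show "1 \<le> \<delta> / \<tau> i" using tau[of i] by (simp add: S_def)
    qed
    then have "real m \<le> ?s" unfolding s by simp
    with le[OF mn] have "4 * ?s \<le> 1 / p" by linarith
    then have "p * ?s \<le> 1 / 4" using p by (simp add: field_simps)
    moreover have "real (\<Sum>i\<in>S. nat \<lfloor>\<delta> / \<tau> i\<rfloor>) \<le> ?s"
      unfolding s S of_nat_sum
    proof (rule sum_mono)
      fix i assume "i \<in> {1..m}"
      then have "i \<in> S" by (simp add: S)
      then have "\<delta> / \<tau> i \<ge> 0" using tau[of i] \<delta> by (simp add: S_def)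
      then show "real (nat \<lfloor>\<delta> / \<tau> i\<rfloor>) \<le> \<delta> / \<tau> i" by (rule of_nat_floor)
    qed
    then have "p * real (\<Sum>i\<in>S. nat \<lfloor>\<delta> / \<tau> i\<rfloor>) \<le> p * ?s" using p by (intro mult_left_mono) auto
    ultimately show ?thesis unfolding sum_S by linarith
  qed
qed

text \<open>The \<open>d\<close> coordinates take at least \<open>d / 2\<close> phases of length \<open>\<delta>\<close>.  The offsets cost \<open>c * \<mu> * d\<close>
  of the depth \<open>c * R / sqrt d\<close>, and the choice of \<open>\<mu>\<close> makes this one half of it.\<close>

lemma lower_bound:
  fixes \<tau> :: "nat \<Rightarrow> real" and \<sigma> R L M \<epsilon> :: real and A :: "nat \<Rightarrow> alg"
  assumes n: "n \<ge> 1" and pos: "\<sigma> > 0" "R > 0" "L > 0" "M > 0" "\<epsilon> > 0"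
    and tau1: "0 < \<tau> 1" and mono_all: "\<forall>i j. 1 \<le> i \<and> i \<le> j \<and> j \<le> n \<longrightarrow> \<tau> i \<le> \<tau> j"
    and big: "sqrt L * R > 25 * sqrt \<epsilon>" "M\<^sup>2 * R\<^sup>2 > 25 * \<epsilon>\<^sup>2"
    and alg: "\<forall>d\<ge>1. alg_zr n d R (A d)"
    and t: "t = 1 / 500 * Min ((\<lambda>m. inverse ((1 / real m) * (\<Sum>i=1..m. 1 / \<tau> i)) *
        (min (sqrt L * R / sqrt \<epsilon>) (M\<^sup>2 * R\<^sup>2 / \<epsilon>\<^sup>2) + \<sigma>\<^sup>2 * R\<^sup>2 / (real m * \<epsilon>\<^sup>2))) ` {1..n})"
  shows "\<exists>d\<ge>1. \<exists>(f::vec \<Rightarrow> real) (D::nat \<Rightarrow> real measure) (G::vec \<Rightarrow> real \<Rightarrow> vec).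
         F_conv d R M L f \<and> oracle_ok d n R \<sigma> f D G \<and>
         (\<integral>\<^sup>+\<omega>. ennreal ((INF k\<in>S_set (A d) \<tau> G \<omega> t. f (point_seq (A d) \<tau> G \<omega> k))
                           - (INF x\<in>vball d R. f x)) \<partial>xi_space n D) > ennreal \<epsilon>"
proof -
  define B where "B = min (sqrt L * R / sqrt \<epsilon>) (M\<^sup>2 * R\<^sup>2 / \<epsilon>\<^sup>2)"
  \<comment> \<open>With \<open>c\<close> as below, \<open>c \<le> M\<close> requires
    \<open>d\<close> to be at most 1/25 of the second term of \<open>B\<close>; the first term
    leaves slack for \<open>c / \<mu> \<le> L\<close>.\<close>
  define d where "d = nat \<lfloor>B / 25\<rfloor>"
  define \<mu> where "\<mu> = R / (2 * real d * sqrt d)"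
  \<comment> \<open>Depth \<open>5 * \<epsilon>\<close>: one half goes to the offsets, another half
    to the probability 1/2, and \<open>5 * \<epsilon> / 4\<close> remains.\<close>
  define c where "c = 5 * \<epsilon> * sqrt d / R"
  define p where "p = min 1 (c\<^sup>2 / \<sigma>\<^sup>2)"
  define s where "s = (\<lambda>m. \<Sum>i=1..m. 1 / \<tau> i)"
  define q where "q = (\<lambda>m. (real m + 1 / p) / s m)"
  \<comment> \<open>The factor 1/5 is the one required by \<open>capacity_bound\<close>.\<close>
  define \<delta> where "\<delta> = 1 / 5 * Min (q ` {1..n})"
  have mono: "\<tau> i \<le> \<tau> j" if "1 \<le> i" "i \<le> j" "j \<le> n" for i j using mono_all that by blast
  have tau: "\<tau> i > 0" if "i \<in> {1..n}" for i using tau1 mono[of 1 i] that by force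
  have s_pos: "s m > 0" if "m \<in> {1..n}" for m
    unfolding s_def using that by (intro sum_pos) (auto simp: tau)
  have "sqrt L * R / sqrt \<epsilon> > 25" "M\<^sup>2 * R\<^sup>2 / \<epsilon>\<^sup>2 > 25"
    using big pos by (simp_all add: field_simps)
  then have B: "B > 25" by (simp add: B_def)
  have "real d = of_int \<lfloor>B / 25\<rfloor>" unfolding d_def using B by simp
  then have d: "1 \<le> d" "real d \<le> B / 25" "B \<le> 50 * real d"
  proof -
    assume r: "real d = of_int \<lfloor>B / 25\<rfloor>"
    have "1 \<le> \<lfloor>B / 25\<rfloor>" using B by simp
    with r have "1 \<le> real d" by linarith
    moreover from r show "real d \<le> B / 25" by linarith
    \<comment> \<open>Rounding down loses at most a factor 2, as
      \<open>d + 1 \<le> 2 * d\<close>.\<close>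
    moreover from r have "B / 25 < real d + 1" by linarith
    ultimately show "1 \<le> d" "B \<le> 50 * real d" by linarith+
  qed
  have d0: "real d > 0" and sd: "sqrt d * sqrt d = real d" using d(1) by auto
  have \<mu>: "\<mu> > 0" using d0 pos by (simp add: \<mu>_def)
  have c: "c > 0" using d0 pos by (simp add: c_def)
  have c2: "c\<^sup>2 = 25 * \<epsilon>\<^sup>2 * real d / R\<^sup>2"
    by (simp add: c_def power_divide power_mult_distrib)
  have cM: "c \<le> M"
  proof (rule power2_le_imp_le)
    have "B \<le> M\<^sup>2 * R\<^sup>2 / \<epsilon>\<^sup>2" by (simp add: B_def)
    then have "real d \<le> M\<^sup>2 * R\<^sup>2 / \<epsilon>\<^sup>2 / 25"
      by (intro order_trans[OF d(2)] divide_right_mono) auto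
    then show "c\<^sup>2 \<le> M\<^sup>2" using pos by (simp add: c2 field_simps)
  qed (use pos in simp)
  have cL: "c / \<mu> \<le> L"
  proof -
    have "B \<le> sqrt L * R / sqrt \<epsilon>" by (simp add: B_def)
    then have "real d \<le> sqrt L * R / sqrt \<epsilon> / 25"
      by (intro order_trans[OF d(2)] divide_right_mono) auto
    then have "(real d)\<^sup>2 \<le> (sqrt L * R / sqrt \<epsilon> / 25)\<^sup>2" by (rule power_mono) simp
    also have "\<dots> = L * R\<^sup>2 / \<epsilon> / 625" using pos by (simp add: power_divide power_mult_distrib)
    finally have "10 * \<epsilon> * (real d)\<^sup>2 / R\<^sup>2 \<le> 10 / 625 * L" using pos by (simp add: field_simps)
    also have "\<dots> \<le> L" using pos by simp
    also have "10 * \<epsilon> * (real d)\<^sup>2 / R\<^sup>2 = c / \<mu>"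
      using d0 pos by (simp add: c_def \<mu>_def power2_eq_square field_simps)
    finally show ?thesis .
  qed
  have p: "0 < p" "p \<le> 1" using c pos by (auto simp: p_def)
  have var: "c\<^sup>2 * (1 - p) \<le> p * \<sigma>\<^sup>2"
  proof (cases "c\<^sup>2 / \<sigma>\<^sup>2 \<le> 1")
    case True
    then have "p * \<sigma>\<^sup>2 = c\<^sup>2" using pos by (simp add: p_def)
    then show ?thesis using p by (simp add: mult_left_le)
  next
    case False
    then have "p = 1" by (simp add: p_def)
    then show ?thesis by simp
  qed
  \<comment> \<open>The noise term is of order \<open>d / p\<close>; the constant 50 matches the
    bound on \<open>B\<close>, so that both terms combine into \<open>q\<close>.\<close>
  have noise: "\<sigma>\<^sup>2 * R\<^sup>2 / \<epsilon>\<^sup>2 \<le> 50 * real d * (1 / p)"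
  proof -
    have "p * \<sigma>\<^sup>2 \<le> c\<^sup>2" using pos by (simp add: p_def min_def field_simps)
    then have "p * (\<sigma>\<^sup>2 * R\<^sup>2 / \<epsilon>\<^sup>2) \<le> c\<^sup>2 * R\<^sup>2 / \<epsilon>\<^sup>2"
      using pos by (simp add: divide_right_mono mult_right_mono flip: mult.assoc)
    also have "\<dots> = 25 * real d" using pos by (simp add: c2)
    also have "\<dots> \<le> 50 * real d" by simp
    finally show ?thesis using p by (simp add: field_simps)
  qed
  have q_pos: "q m > 0" if "m \<in> {1..n}" for m
    using s_pos[OF that] p by (simp add: q_def add_nonneg_pos)
  \<comment> \<open>The minimum in \<open>t\<close> is bounded by its value at the minimiser of
    \<open>q\<close>, which need not minimise \<open>v\<close>.\<close>
  have "Min (q ` {1..n}) \<in> q ` {1..n}" using n by (intro Min_in) auto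
  then obtain m where m: "m \<in> {1..n}" "Min (q ` {1..n}) = q m" by auto
  have \<delta>: "\<delta> > 0" using q_pos[OF m(1)] unfolding \<delta>_def m(2) by simp
  have cap: "p * real (\<Sum>i=1..n. nat \<lfloor>\<delta> / \<tau> i\<rfloor>) \<le> 1 / 4"
  proof (rule capacity_bound[OF tau mono p(1) \<delta>])
    fix k assume k: "k \<in> {1..n}"
    have "5 * \<delta> \<le> q k" unfolding \<delta>_def using k by simp
    then have "5 * \<delta> * s k \<le> real k + 1 / p" using s_pos[OF k] by (simp add: q_def field_simps)
    then show "5 * \<delta> * (\<Sum>i=1..k. 1 / \<tau> i) \<le> real k + 1 / p" unfolding s_def .
  qed
  define v where "v = (\<lambda>m. inverse ((1 / real m) * s m) * (B + \<sigma>\<^sup>2 * R\<^sup>2 / (real m * \<epsilon>\<^sup>2)))"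
  have tv: "t = 1 / 500 * Min (v ` {1..n})" by (simp add: t v_def s_def B_def)
  have "v k \<ge> 0" if "k \<in> {1..n}" for k
    unfolding v_def using s_pos[OF that] B pos
    by (intro mult_nonneg_nonneg add_nonneg_nonneg divide_nonneg_nonneg) auto
  then have t0: "0 \<le> t" unfolding tv using n by simp
  have "v m = (real m * B + \<sigma>\<^sup>2 * R\<^sup>2 / \<epsilon>\<^sup>2) / s m"
    using m(1) s_pos[OF m(1)] pos by (simp add: v_def field_simps)
  also have "\<dots> \<le> (real m * (50 * real d) + 50 * real d * (1 / p)) / s m"
    using s_pos[OF m(1)] d noise by (intro divide_right_mono add_mono mult_left_mono) auto
  also have "\<dots> = 50 * real d * q m" by (simp add: q_def algebra_simps add_divide_distrib)
  also have "\<dots> = 250 * real d * \<delta>" unfolding \<delta>_def m(2) by simp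
  finally have "v m \<le> 250 * real d * \<delta>" .
  moreover have "Min (v ` {1..n}) \<le> v m" using m by simp
  ultimately have "Min (v ` {1..n}) \<le> 250 * (\<delta> * real d)" by (simp only: mult_ac)
  \<comment> \<open>The constant 1/500 turns the factor 250 into 1/2.\<close>
  then have t_le: "t \<le> \<delta> * real d / 2" unfolding tv by simp
  have "c * (\<mu> * d) = 5 * \<epsilon> / 2" using d0 pos by (simp add: c_def \<mu>_def)
  moreover have "c * (R / sqrt d) = 5 * \<epsilon>" using d0 pos by (simp add: c_def)
  ultimately have gap: "5 * \<epsilon> / 2 \<le> c * (R / sqrt d) - c * (\<mu> * d)" by simp
  have "ennreal \<epsilon> < ennreal (5 * \<epsilon> / 2 / 2)" using pos by (simp add: ennreal_lessI)
  also note hard_instance_gap[OF alg[rule_format, OF d(1)] tau d(1) \<mu> less_imp_le[OF c] p pos(2) \<delta> cap t0 t_le _ gap]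
  finally have "ennreal \<epsilon> < (\<integral>\<^sup>+\<omega>. ennreal ((INF k\<in>S_set (A d) \<tau> (bit_oracle d \<mu> c p) \<omega> t.
      c * smooth_max d \<mu> (point_seq (A d) \<tau> (bit_oracle d \<mu> c p) \<omega> k))
      - (INF x\<in>vball d R. c * smooth_max d \<mu> x)) \<partial>xi_space n (\<lambda>_. bit_measure p))"
    using pos by simp
  with F_conv_smooth_max[OF d(1) \<mu> less_imp_le[OF c] cM cL] oracle_ok_bit_oracle[OF d(1) \<mu> p var]
  show ?thesis
    by (intro exI[of _ d] exI[of _ "\<lambda>x. c * smooth_max d \<mu> x"] exI[of _ "\<lambda>_. bit_measure p"]
        exI[of _ "bit_oracle d \<mu> c p"] conjI d(1))
qed

theorem mainTheorem7:
  shows "\<exists>c c1 c2 :: real. c > 0 \<and> c1 > 0 \<and> c2 > 0 \<and>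
    (\<forall>(n::nat) (\<sigma>::real) (\<tau>::nat \<Rightarrow> real) (R::real) (L::real) (M::real) (\<epsilon>::real) (A::nat \<Rightarrow> alg).
      n \<ge> 1 \<and> \<sigma> > 0 \<and> 0 < \<tau> 1 \<and> (\<forall>i j. 1 \<le> i \<and> i \<le> j \<and> j \<le> n \<longrightarrow> \<tau> i \<le> \<tau> j) \<and>
      R > 0 \<and> L > 0 \<and> M > 0 \<and> \<epsilon> > 0 \<and>
      sqrt L * R > c1 * sqrt \<epsilon> \<and> M\<^sup>2 * R\<^sup>2 > c2 * \<epsilon>\<^sup>2 \<and>
      (\<forall>d\<ge>1. alg_zr n d R (A d)) \<longrightarrow>
      (let t = c * Min ((\<lambda>m. inverse ((1 / real m) * (\<Sum>i=1..m. 1 / \<tau> i)) *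
                   (min (sqrt L * R / sqrt \<epsilon>) (M\<^sup>2 * R\<^sup>2 / \<epsilon>\<^sup>2) + \<sigma>\<^sup>2 * R\<^sup>2 / (real m * \<epsilon>\<^sup>2))) ` {1..n})
       in \<exists>d\<ge>1. \<exists>(f::vec \<Rightarrow> real) (D::nat \<Rightarrow> real measure) (G::vec \<Rightarrow> real \<Rightarrow> vec).
         F_conv d R M L f \<and> oracle_ok d n R \<sigma> f D G \<and>
         (\<integral>\<^sup>+\<omega>. ennreal ((INF k\<in>S_set (A d) \<tau> G \<omega> t. f (point_seq (A d) \<tau> G \<omega> k))
                           - (INF x\<in>vball d R. f x)) \<partial>xi_space n D) > ennreal \<epsilon>))"
proof (intro exI conjI allI impI)
  show "1 / 500 > (0::real)" "25 > (0::real)" "25 > (0::real)" by simp_all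
qed (elim conjE, unfold Let_def, rule lower_bound; (rule refl | assumption))

end
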